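(* Let $F$ be a non-Archimedean local field or a finite field, let $n$ be a natural number and let $k\in\{1,2\}$. Let $$X_{n,k}:=\{(A,B): A,B\in \mathrm{Mat}_{n+k}(F),\ AB=BA=0,\ \mathrm{rank}(A)=n,\ \mathrm{rank}(B)=k\},$$ let $G=\mathrm{GL}_{n+k}(F)$ act on $X_{n,k}$ by (simultaneous) conjugation, and define $\theta:X_{n,k}\to X_{n,k}$ by $\theta(A,B):=(A^t,B^t)$. Then every $G$-orbit in $X_{n,k}$ is $\theta$-invariant.
   Context: $A^t$ denotes the transpose of the matrix $A$. *)

theory Defs
  imports
    "HOL-Analysis.Abstract_Metric_Spaces"
    "HOL-Algebra.Group_Action"
    "Jordan_Normal_Form.DL_Rank"
begin

definition nonarch_abs_value :: "('a::field \<Rightarrow> real) \<Rightarrow> bool" where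
  "nonarch_abs_value v \<longleftrightarrow>
     (\<forall>x. 0 \<le> v x) \<and>
     (\<forall>x. v x = 0 \<longleftrightarrow> x = 0) \<and>
     (\<forall>x y. v (x * y) = v x * v y) \<and>
     (\<forall>x y. v (x + y) \<le> max (v x) (v y))"

text \<open>A non-Archimedean local field is a field whose topology comes from a nontrivial
  non-Archimedean absolute value and is locally compact. Completeness, discreteness of the
  value group and finiteness of the residue field follow from local compactness. No
  assumption is made on the characteristic.\<close>

definition nonarch_local_field :: "'a::field itself \<Rightarrow> bool" where
  "nonarch_local_field _ \<longleftrightarrow>
     (\<exists>v :: 'a \<Rightarrow> real. nonarch_abs_value v \<and> (\<exists>x. x \<noteq> 0 \<and> v x \<noteq> 1) \<and>
        locally_compact_space (Metric_space.mtopology UNIV (\<lambda>x y. v (x - y))))"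

definition GL :: "'a::field itself \<Rightarrow> nat \<Rightarrow> 'a mat monoid" where
  "GL ty m = units_of (ring_mat ty m ())"

definition X :: "nat \<Rightarrow> nat \<Rightarrow> ('a::field mat \<times> 'a mat) set" where
  "X n k = {(A, B).
     A \<in> carrier_mat (n + k) (n + k) \<and> B \<in> carrier_mat (n + k) (n + k) \<and>
     A * B = 0\<^sub>m (n + k) (n + k) \<and> B * A = 0\<^sub>m (n + k) (n + k) \<and>
     vec_space.rank (n + k) A = n \<and> vec_space.rank (n + k) B = k}"

text \<open>The restriction to \<^term>\<open>X n k\<close> only serves to match the convention of
  \<^locale>\<open>group_action\<close>, whose bijections are extensional functions.\<close>

definition conj_action :: "nat \<Rightarrow> nat \<Rightarrow> 'a::field mat \<Rightarrow> 'a mat \<times> 'a mat \<Rightarrow> 'a mat \<times> 'a mat" where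
  "conj_action n k g = (\<lambda>(A, B) \<in> X n k.
     (g * A * inv\<^bsub>GL TYPE('a) (n + k)\<^esub> g, g * B * inv\<^bsub>GL TYPE('a) (n + k)\<^esub> g))"

definition theta :: "'a mat \<times> 'a mat \<Rightarrow> 'a mat \<times> 'a mat" where
  "theta = (\<lambda>(A, B). (transpose_mat A, transpose_mat B))"

end

theory Submission
  imports
    Defs
    "HOL-Analysis.Cartesian_Space"
    "HOL-Computational_Algebra.Polynomial_Factorial"
    "HOL-Library.Function_Algebras"
begin

text \<open>It suffices to find, for each pair \<open>(A, B)\<close>, a nondegenerate symmetric bilinear form for which \<open>A\<close>
  and \<open>B\<close> are both self-adjoint: its Gram matrix conjugates \<open>(A, B)\<close> into \<open>(A\<^sup>t, B\<^sup>t)\<close>. For \<open>A\<close> alone such a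
  form exists over any field, as an orthogonal sum of Bezoutian forms on cyclic summands. Since
  \<open>AB = BA = 0\<close> and the ranks add up to the dimension, \<open>ker A = im B\<close> and \<open>ker B = im A\<close>, so \<open>B\<close> amounts to an
  isomorphism from the cokernel of \<open>A\<close> to its kernel, and \<open>\<gamma> (B u) w\<close> is a bilinear form on the
  \<open>k\<close>-dimensional cokernel whose symmetry means that \<open>B\<close> is self-adjoint. For \<open>k = 1\<close> symmetry is
  automatic. For \<open>k = 2\<close> it is one linear condition on \<open>\<gamma>\<close>, and the forms coming from the two nilpotent
  Jordan blocks of \<open>A\<close> and from a map between them leave enough freedom to satisfy it without losing
  nondegeneracy.\<close>

subsection \<open>Prime powers in polynomial rings\<close>

text \<open>Self-adjointness makes \<open>A V\<close> orthogonal to \<open>ker A\<close>, so the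
  form pairs \<open>ker A\<close> with the cokernel of \<open>A\<close>. On the nilpotent part of
  \<open>A\<close> it is nondegenerate iff this pairing is, because a nonzero radical is
  \<open>A\<close>-invariant and would meet \<open>ker A\<close>; symmetry of
  \<open>\<gamma> (B u) w\<close> involves the same pairing. For two nilpotent Jordan blocks its
  matrix has rows (\<alpha>, c \<sigma>) and (\<sigma>, \<delta>): \<alpha> and \<delta> scale the
  forms of the blocks, \<sigma> the mixed form, and c is 1 for blocks of equal size and 0 otherwise.
  With \<open>B\<close> given by b11, b12, b21, b22 the condition is b11 c \<sigma> + b12 \<delta> =
  b21 \<alpha> + b22 \<sigma>. For \<sigma> = 0 it has no solution with \<alpha> \<delta> nonzero
  when exactly one of b12, b21 vanishes, hence the mixed form. Symmetry in dimension k amounts to k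
  (k - 1) / 2 conditions, so k = 2 is the first case with an obstruction. Bezoutian forms are used
  because minimal polynomials may be inseparable or have multiple roots, where trace forms
  degenerate.\<close>

lemma exists_irreducible_factor_poly:
  fixes g :: "'a::field poly"
  assumes "g \<noteq> 0" "\<not> is_unit g"
  shows "\<exists>p. irreducible p \<and> p dvd g"
proof -
  have "g dvd g \<and> \<not> is_unit g" using assms(2) by simp
  from ex_has_least_nat[of "\<lambda>p. p dvd g \<and> \<not> is_unit p", OF this, of degree]
  obtain p where p: "p dvd g" "\<not> is_unit p"
    and min: "\<And>q. q dvd g \<Longrightarrow> \<not> is_unit q \<Longrightarrow> degree p \<le> degree q"
    by blast
  have p0: "p \<noteq> 0" using p(1) assms(1) by auto
  have "irreducible p"
  proof (rule irreducibleI)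
    fix a b assume ab: "p = a * b"
    show "is_unit a \<or> is_unit b"
    proof (rule ccontr)
      assume n: "\<not> (is_unit a \<or> is_unit b)"
      have "a \<noteq> 0" "b \<noteq> 0" using ab p0 by auto
      hence "degree p = degree a + degree b" "degree b \<noteq> 0"
        using ab n by (auto simp: degree_mult_eq is_unit_iff_degree)
      moreover have "degree p \<le> degree a"
        using min[of a] n ab p(1) dvd_mult_left[of a b g] by simp
      ultimately show False by simp
    qed
  qed (use p p0 in auto)
  thus ?thesis using p(1) by blast
qed

lemma prime_power_coprime_dvd:
  fixes p a b :: "'a::idom"
  assumes "prime_elem p" "\<not> p dvd a" "p ^ i dvd a * b"
  shows "p ^ i dvd b"
  using assms(3)
proof (induction i)
  case (Suc i)
  then obtain c where c: "b = p ^ i * c" using power_le_dvd by (metis dvdE le_SucI order_refl)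
  have "p ^ i * p dvd p ^ i * (a * c)" using Suc.prems c by (simp add: mult_ac)
  hence "p dvd a * c" using assms(1) by (simp add: prime_elem_def)
  hence "p dvd c" using assms(1,2) prime_elem_dvd_mult_iff by blast
  thus ?case using c by (simp add: mult.commute[of p])
qed simp

lemma dvd_mult_prime_power:
  fixes p a b :: "'a::idom"
  assumes "prime_elem p" "\<not> p dvd a" "a dvd b * p ^ i"
  shows "a dvd b"
  using assms(3)
proof (induction i)
  case (Suc i)
  then obtain c where c: "b * p ^ Suc i = a * c" by (auto elim: dvdE)
  hence "p dvd a * c" by (metis dvd_triv_right dvd_mult power_Suc dvd_triv_left)
  then obtain e where "c = p * e" using assms(1,2) prime_elem_dvd_mult_iff by (metis dvdE)
  hence "p * (b * p ^ i) = p * (a * e)" using c by (simp add: mult_ac)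
  hence "b * p ^ i = a * e" using assms(1) by (simp add: prime_elem_def)
  thus ?case using Suc.IH by simp
qed simp

lemma factor_out_power_poly:
  fixes g p :: "'a::field poly"
  assumes "g \<noteq> 0" "degree p > 0"
  shows "\<exists>m h. g = p ^ m * h \<and> \<not> p dvd h"
  using assms(1)
proof (induction "degree g" arbitrary: g rule: less_induct)
  case less
  show ?case
  proof (cases "p dvd g")
    case True
    then obtain h where h: "g = p * h" by (auto elim: dvdE)
    hence h0: "h \<noteq> 0" "p \<noteq> 0" using less.prems by auto
    hence "degree h < degree g" using assms(2) h by (simp add: degree_mult_eq)
    then obtain m h' where "h = p ^ m * h'" "\<not> p dvd h'" using less.hyps h0(1) by blast
    hence "g = p ^ Suc m * h' \<and> \<not> p dvd h'" using h by (simp add: mult.assoc)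
    thus ?thesis by blast
  next
    case False
    hence "g = p ^ 0 * g \<and> \<not> p dvd g" by simp
    thus ?thesis by blast
  qed
qed

text \<open>Remove one irreducible factor \<open>p\<close> from \<open>g\<close>, leaving
  \<open>g1\<close>. If \<open>g1\<close> still fails to divide \<open>f\<close>, induct. Otherwise
  \<open>f = g1 * h\<close>, where \<open>p\<close> does not divide \<open>h\<close> because
  \<open>p * g1\<close> does not divide \<open>f\<close>; so \<open>p\<close> occurs in
  \<open>f\<close> exactly as often as in \<open>g1\<close>, once less than in
  \<open>g\<close>.\<close>

lemma not_dvd_imp_prime_power:
  fixes f g :: "'a::field poly"
  assumes "g \<noteq> 0" "\<not> g dvd f"
  shows "\<exists>p i. prime_elem p \<and> p ^ i dvd g \<and> \<not> p ^ i dvd f"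
  using assms
proof (induction "degree g" arbitrary: g rule: less_induct)
  case less
  have "\<not> is_unit g" using less.prems(2) dvd_trans one_dvd by blast
  then obtain p where p: "irreducible p" "p dvd g"
    using exists_irreducible_factor_poly less.prems(1) by blast
  have pp: "prime_elem p" using p(1) by (rule field_poly_irreducible_imp_prime)
  obtain g1 where g1: "g = p * g1" using p(2) by (auto elim: dvdE)
  have n0: "g1 \<noteq> 0" "p \<noteq> 0" using g1 less.prems(1) by auto
  have dp: "degree p > 0" using p(1) n0(2) is_unit_iff_degree by (metis irreducible_not_unit gr0I)
  have dg: "degree g1 < degree g" using n0 dp g1 by (simp add: degree_mult_eq)
  show ?case
  proof (cases "g1 dvd f")
    case False
    then obtain q i where "prime_elem q" "q ^ i dvd g1" "\<not> q ^ i dvd f"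
      using less.hyps[OF dg n0(1)] by blast
    thus ?thesis using g1 by (metis dvd_mult)
  next
    case True
    then obtain h where h: "f = g1 * h" by (auto elim: dvdE)
    have ph: "\<not> p dvd h" using less.prems(2) g1 h by (metis mult.commute mult_dvd_mono dvd_refl)
    obtain m g2 where g2: "g1 = p ^ m * g2" "\<not> p dvd g2"
      using factor_out_power_poly n0(1) dp by blast
    let ?i = "Suc m"
    have "p ^ ?i dvd g" using g1 g2(1) by (metis dvd_triv_left mult.assoc power_Suc)
    moreover have "\<not> p ^ ?i dvd f"
    proof
      assume "p ^ ?i dvd f"
      hence "p ^ m * p dvd p ^ m * (g2 * h)"
        using h g2(1) by (metis mult.assoc mult.commute power_Suc)
      hence "p dvd g2 * h" using n0(2) by simp
      thus False using ph g2(2) pp prime_elem_dvd_mult_iff by blast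
    qed
    ultimately show ?thesis using pp by blast
  qed
qed

subsection \<open>Orders of vectors under a linear operator\<close>

locale linear_operator = vector_space scale
  for scale :: "'a::field \<Rightarrow> 'b::ab_group_add \<Rightarrow> 'b" (infixr "*\<^sub>S" 75) +
  fixes A :: "'b \<Rightarrow> 'b"
  assumes linear_A: "Vector_Spaces.linear scale scale A"
begin

sublocale dual: vector_space_pair scale "(*) :: 'a \<Rightarrow> 'a \<Rightarrow> 'a" ..

sublocale endo: vector_space_pair scale scale ..

end

(* For the field as a space over itself this simp rule reverses mult.assoc. *)
declare (in linear_operator) dual.vs2.scale_scale [simp del]

context linear_operator
begin

abbreviation functional :: "('b \<Rightarrow> 'a) \<Rightarrow> bool" where
  "functional \<equiv> Vector_Spaces.linear scale (*)"

abbreviation operator :: "('b \<Rightarrow> 'b) \<Rightarrow> bool" where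
  "operator \<equiv> Vector_Spaces.linear scale scale"

lemma A_simps:
  "A (u + w) = A u + A w" "A (u - w) = A u - A w" "A (c *\<^sub>S u) = c *\<^sub>S A u" "A 0 = 0"
  "A (- u) = - A u" "A (sum h I) = (\<Sum>i\<in>I. A (h i))"
  using linear_A by (simp_all add: endo.linear_add endo.linear_diff endo.linear_scale endo.linear_0
   endo.linear_neg endo.linear_sum)

lemma linear_pow: "operator (A ^^ n)"
proof (induction n)
  case (Suc n)
  thus ?case using Vector_Spaces.linear_compose[OF Suc linear_A] by (simp add: comp_def)
qed (simp add: linear_id id_def[symmetric])

lemma pow_simps:
  "(A ^^ n) (u + w) = (A ^^ n) u + (A ^^ n) w" "(A ^^ n) (u - w) = (A ^^ n) u - (A ^^ n) w"
  "(A ^^ n) (c *\<^sub>S u) = c *\<^sub>S (A ^^ n) u" "(A ^^ n) 0 = 0"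
  "(A ^^ n) (sum h I) = (\<Sum>i\<in>I. (A ^^ n) (h i))"
  using linear_pow[of n] by (simp_all add: endo.linear_add endo.linear_diff endo.linear_scale
   endo.linear_0 endo.linear_sum)

lemma exists_functional:
  assumes "subspace S" "x \<notin> S"
  obtains \<phi> where "functional \<phi>" "\<And>s. s \<in> S \<Longrightarrow> \<phi> s = 0" "\<phi> x = 1"
proof -
  obtain B where B: "B \<subseteq> S" "independent B" "S \<subseteq> span B"
    using maximal_independent_subset by blast
  have x: "x \<notin> span B" using B(1) assms span_minimal by blast
  hence "independent (insert x B)" using B(2) by (simp add: independent_insertI)
  then obtain \<phi> where phi: "functional \<phi>" "\<forall>y\<in>insert x B. \<phi> y = (if y = x then 1 else 0)"
    using dual.linear_independent_extend[where f = "\<lambda>y. if y = x then 1 else 0"] by blast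
  have "\<phi> s = 0" if "s \<in> S" for s
  proof (rule dual.linear_eq_0_on_span[OF phi(1), of B])
    show "s \<in> span B" using that B(3) by blast
  qed (use phi x span_base in force)
  thus ?thesis using that phi by auto
qed

section \<open>Polynomials in the operator\<close>

definition act :: "'a poly \<Rightarrow> 'b \<Rightarrow> 'b" where
  "act p u = (\<Sum>i\<le>degree p. coeff p i *\<^sub>S (A ^^ i) u)"

lemma act_altdef: "degree p \<le> n \<Longrightarrow> act p u = (\<Sum>i\<le>n. coeff p i *\<^sub>S (A ^^ i) u)"
  unfolding act_def by (rule sum.mono_neutral_left) (auto simp: coeff_eq_0)

lemma act_0 [simp]: "act 0 u = 0"
  by (simp add: act_def)

lemma act_pCons: "act (pCons c p) u = c *\<^sub>S u + A (act p u)"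
proof -
  have "act (pCons c p) u = (\<Sum>i\<le>Suc (degree p). coeff (pCons c p) i *\<^sub>S (A ^^ i) u)"
    by (rule act_altdef) (rule degree_pCons_le)
  also have "\<dots> = c *\<^sub>S u + (\<Sum>i\<le>degree p. coeff p i *\<^sub>S (A ^^ Suc i) u)"
    by (subst sum.atMost_Suc_shift) simp
  also have "(\<Sum>i\<le>degree p. coeff p i *\<^sub>S (A ^^ Suc i) u) = A (act p u)"
    by (simp add: act_def A_simps)
  finally show ?thesis .
qed

lemma act_1 [simp]: "act 1 u = u"
  by (simp add: act_def)

lemma linear_act: "operator (act p)"
  unfolding Vector_Spaces.linear_iff
  by (simp add: vector_space_axioms act_def pow_simps scale_right_distrib sum.distrib
      scale_sum_right mult.commute)

lemma act_simps:
  "act p (u + w) = act p u + act p w" "act p (u - w) = act p u - act p w"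
  "act p (c *\<^sub>S u) = c *\<^sub>S act p u" "act p 0 = 0"
  using linear_act[of p] by (simp_all add: endo.linear_add endo.linear_diff endo.linear_scale
   endo.linear_0)

lemma act_add: "act (p + q) u = act p u + act q u"
proof (induction p arbitrary: q)
  case (pCons c p)
  then show ?case by (cases q) (simp add: act_pCons A_simps algebra_simps)
qed simp

lemma act_smult: "act (Polynomial.smult c p) u = c *\<^sub>S act p u"
  by (induction p) (simp_all add: act_pCons A_simps algebra_simps)

lemma act_mult: "act (p * q) u = act p (act q u)"
  by (induction p) (simp_all add: act_pCons act_add act_smult)

lemma act_minus: "act (p - q) u = act p u - act q u"
  using act_add[of "p - q" q u] by (simp add: eq_diff_eq)

lemma act_dvd_0: "p dvd q \<Longrightarrow> act p u = 0 \<Longrightarrow> act q u = 0"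
  by (auto elim!: dvdE simp: mult.commute[of p] act_mult act_simps)

lemma act_pow: "act (monom 1 n) u = (A ^^ n) u"
  by (induction n) (simp_all add: monom_0 act_pCons monom_Suc A_simps)


text \<open>The ambient space may have infinite dimension (it will be a space of sequences), so
  finite dimension is asked of the subspace only, through a finite spanning set.\<close>

definition fd_invariant :: "'b set \<Rightarrow> bool" where
  "fd_invariant U \<longleftrightarrow> subspace U \<and> (\<forall>u\<in>U. A u \<in> U) \<and> (\<exists>T. finite T \<and> U \<subseteq> span T)"

lemma pow_in: "fd_invariant U \<Longrightarrow> u \<in> U \<Longrightarrow> (A ^^ n) u \<in> U"
  by (induction n) (auto simp: fd_invariant_def)

lemma act_in: "fd_invariant U \<Longrightarrow> u \<in> U \<Longrightarrow> act p u \<in> U"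
  unfolding act_def by (intro subspace_sum subspace_scale pow_in) (auto simp: fd_invariant_def)

lemma exists_annihilating_poly:
  assumes "finite T" "\<And>i. (A ^^ i) u \<in> span T"
  shows "\<exists>p. p \<noteq> 0 \<and> degree p \<le> card T \<and> act p u = 0"
proof -
  let ?n = "card T" and ?g = "\<lambda>i. (A ^^ i) u"
  show ?thesis
  \<comment> \<open>Independence is a property of sets, so a repeated power would not show up as a
    linear dependence; it gives a difference of two monomials instead.\<close>
  proof (cases "inj_on ?g {..?n}")
    case True
    have "\<not> independent (?g ` {..?n})"
    proof
      assume "independent (?g ` {..?n})"
      hence "card (?g ` {..?n}) \<le> card T"
        using independent_span_bound[OF assms(1)] assms(2) by blast
      thus False by (simp add: card_image[OF True])
    qed
    then obtain c y where c: "(\<Sum>x\<in>?g ` {..?n}. c x *\<^sub>S x) = 0" "y \<in> ?g ` {..?n}" "c y \<noteq> 0"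
      using independent_if_scalars_zero[of "?g ` {..?n}"] by blast
    define p where "p = (\<Sum>i\<le>?n. monom (c (?g i)) i)"
    have coeff: "coeff p i = (if i \<le> ?n then c (?g i) else 0)" for i
      by (simp add: p_def coeff_sum)
    have deg: "degree p \<le> ?n" by (intro degree_le) (simp add: coeff)
    obtain i where "i \<le> ?n" "y = ?g i" using c(2) by auto
    hence "coeff p i \<noteq> 0" using c(3) coeff by simp
    hence "p \<noteq> 0" by auto
    moreover have "act p u = (\<Sum>x\<in>?g ` {..?n}. c x *\<^sub>S x)"
      by (simp add: act_altdef[OF deg] coeff sum.reindex[OF True])
    ultimately show ?thesis using deg c(1) by auto
  next
    case False
    then obtain i j where ij: "i < j" "j \<le> ?n" "?g i = ?g j"
      by (auto simp: inj_on_def) (metis linorder_neqE_nat)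
    have "act (monom 1 j - monom 1 i) u = 0" using ij(3) by (simp add: act_minus act_pow)
    moreover have "monom (1::'a) j - monom 1 i \<noteq> 0" using ij(1)
      by (metis coeff_diff coeff_monom coeff_0 diff_zero less_irrefl zero_neq_one)
    moreover have "degree (monom (1::'a) j - monom 1 i) \<le> ?n"
      using ij by (intro degree_diff_le) (auto intro: order.trans[OF degree_monom_le])
    ultimately show ?thesis by blast
  qed
qed

text \<open>\<open>g\<close> generates the annihilator of \<open>u\<close> in the module over
  \<open>'a poly\<close> given by \<open>act\<close>; it is unique up to a scalar.\<close>

definition is_order :: "'a poly \<Rightarrow> 'b \<Rightarrow> bool" where
  "is_order g u \<longleftrightarrow> g \<noteq> 0 \<and> (\<forall>r. act r u = 0 \<longleftrightarrow> g dvd r)"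

lemma exists_order:
  assumes "p \<noteq> 0" "act p u = 0"
  shows "\<exists>g. is_order g u"
proof -
  have "p \<noteq> 0 \<and> act p u = 0" using assms by blast
  from ex_has_least_nat[of "\<lambda>p. p \<noteq> 0 \<and> act p u = 0", OF this, of degree]
  obtain g where g: "g \<noteq> 0" "act g u = 0"
    and min: "\<And>r. r \<noteq> 0 \<Longrightarrow> act r u = 0 \<Longrightarrow> degree g \<le> degree r"
    by blast
  have "g dvd r" if r: "act r u = 0" for r
  proof -
    have "act r u = act (r div g) (act g u) + act (r mod g) u"
      by (metis act_add act_mult div_mult_mod_eq)
    hence "act (r mod g) u = 0" using r g(2) by (simp add: act_simps)
    hence "r mod g = 0" using min[of "r mod g"] degree_mod_less'[OF g(1), of r] by linarith
    thus ?thesis by (simp add: dvd_eq_mod_eq_0)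
  qed
  thus ?thesis using g act_dvd_0 unfolding is_order_def by blast
qed

lemma is_order_act:
  assumes "is_order (p * q) u"
  shows "is_order q (act p u)"
proof -
  have "act r (act p u) = 0 \<longleftrightarrow> q dvd r" for r
  proof -
    have "act r (act p u) = 0 \<longleftrightarrow> p * q dvd p * r"
      using assms by (simp add: is_order_def act_mult[symmetric] mult.commute)
    thus ?thesis using assms by (simp add: is_order_def)
  qed
  thus ?thesis using assms by (simp add: is_order_def)
qed

text \<open>A vector of maximal order realises the minimal polynomial: otherwise some prime power divides
  the order of another vector to a higher exponent, and the sum of suitable multiples of the two
  vectors has an order of larger degree.\<close>

lemma exists_vector_of_maximal_order:
  assumes U: "fd_invariant U"
  obtains v f where "v \<in> U" "is_order f v" "lead_coeff f = 1" "\<And>u. u \<in> U \<Longrightarrow> act f u = 0"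
proof -
  from U obtain T where T: "finite T" "U \<subseteq> span T" by (auto simp: fd_invariant_def)
  have ann: "\<exists>p. p \<noteq> 0 \<and> degree p \<le> card T \<and> act p u = 0" if "u \<in> U" for u
    by (rule exists_annihilating_poly[OF T(1)]) (use pow_in[OF U that] T(2) in blast)
  have ex: "\<exists>g. is_order g u" if "u \<in> U" for u using ann[OF that] exists_order by blast
  have bound: "degree g \<le> card T" if "u \<in> U" "is_order g u" for g u
    using ann[OF that(1)] that(2) unfolding is_order_def by (meson dvd_imp_degree_le order_trans)
  let ?P = "\<lambda>d. \<exists>v\<in>U. \<exists>f. is_order f v \<and> degree f = d"
  have "0 \<in> U" using U by (simp add: fd_invariant_def subspace_0)
  hence "\<exists>d. ?P d" using ex by blast
  then obtain d0 where d0: "?P d0" by blast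
  have bd: "\<And>d. ?P d \<Longrightarrow> d \<le> card T" using bound by blast
  have "?P (GREATEST d. ?P d)" by (rule GreatestI_nat[of ?P, OF d0 bd])
  then obtain d where d: "?P d" "\<And>e. ?P e \<Longrightarrow> e \<le> d"
    using Greatest_le_nat[of ?P, OF _ bd] by blast
  then obtain v f where v: "v \<in> U" "is_order f v" "degree f = d" by blast
  have f0: "f \<noteq> 0" using v(2) by (simp add: is_order_def)
  have kill: "act f u = 0" if u: "u \<in> U" for u
  proof (rule ccontr)
    assume nz: "act f u \<noteq> 0"
    obtain g where g: "is_order g u" using ex u by blast
    hence "g \<noteq> 0" "\<not> g dvd f" using nz by (auto simp: is_order_def)
    then obtain p i where p: "prime_elem p" "p ^ i dvd g" "\<not> p ^ i dvd f"
      using not_dvd_imp_prime_power by blast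
    have p0: "p \<noteq> 0" "\<not> is_unit p" using p(1) by (auto simp: prime_elem_def)
    hence dp: "degree p > 0" using is_unit_iff_degree by blast
    obtain j f' where f': "f = p ^ j * f'" "\<not> p dvd f'"
      using factor_out_power_poly[OF f0 dp] by blast
    have ji: "j < i"
    proof (rule ccontr)
      assume "\<not> j < i"
      hence "p ^ i dvd f" using f'(1) by (meson dvd_mult2 le_imp_power_dvd not_le)
      thus False using p(3) by blast
    qed
    obtain g' where g': "g = g' * p ^ i" using p(2) by (metis dvdE mult.commute)
    \<comment> \<open>These have the orders \<open>f'\<close> and \<open>p ^ i\<close>, and
      \<open>p\<close> does not divide \<open>f'\<close>. The order \<open>h\<close> of their sum is
      a multiple of \<open>f' * p ^ i\<close>: since \<open>f' * h\<close> kills the sum and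
      \<open>?v\<close>, it kills \<open>?u\<close>, and likewise with \<open>p ^ i * h\<close> and
      the roles exchanged. By \<open>j < i\<close> this exceeds the degree of
      \<open>f\<close>.\<close>
    let ?v = "act (p ^ j) v" and ?u = "act g' u"
    have ov: "is_order f' ?v" using v(2) f'(1) by (intro is_order_act) simp
    have ou: "is_order (p ^ i) ?u" using g g' by (intro is_order_act) simp
    have wU: "?v + ?u \<in> U" using act_in[OF U] v(1) u U by (simp add: fd_invariant_def subspace_add)
    then obtain h where h: "is_order h (?v + ?u)" using ex by blast
    have hs: "act (q * h) ?v + act (q * h) ?u = 0" for q
      using h by (metis act_simps(1) dvd_triv_right is_order_def)
    have "act (f' * h) ?v = 0" using ov by (simp add: is_order_def)
    hence "act (f' * h) ?u = 0" using hs[of f'] by simp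
    hence "p ^ i dvd f' * h" using ou by (simp add: is_order_def)
    hence ph: "p ^ i dvd h" using prime_power_coprime_dvd[OF p(1) f'(2)] by blast
    have "act (p ^ i * h) ?u = 0" using ou by (simp add: is_order_def)
    hence "act (p ^ i * h) ?v = 0" using hs[of "p ^ i"] by simp
    hence "f' dvd h * p ^ i" using ov by (simp add: is_order_def mult.commute)
    hence "f' dvd h" using dvd_mult_prime_power[OF p(1) f'(2)] by blast
    then obtain c where c: "h = f' * c" by (auto elim: dvdE)
    hence "p ^ i dvd c" using ph prime_power_coprime_dvd[OF p(1) f'(2)] by blast
    hence "f' * p ^ i dvd h" using c by simp
    moreover have "h \<noteq> 0" using h by (simp add: is_order_def)
    ultimately have "degree (f' * p ^ i) \<le> degree h" by (rule dvd_imp_degree_le)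
    also have "degree h \<le> degree f" using d(2) wU h v(3) by blast
    finally have "i * degree p \<le> j * degree p"
      using f'(1) f0 p0(1) by (simp add: degree_mult_eq degree_power_eq)
    thus False using ji dp by simp
  qed
  let ?f = "Polynomial.smult (inverse (lead_coeff f)) f"
  have lc: "inverse (lead_coeff f) \<noteq> 0" using f0 by simp
  have "is_order ?f v" using v(2) lc f0 by (simp add: is_order_def smult_dvd_iff)
  moreover have "lead_coeff ?f = 1" using f0 by simp
  moreover have "act ?f u = 0" if "u \<in> U" for u using kill[OF that] by (simp add: act_smult)
  ultimately show ?thesis using that v(1) by blast
qed

end

subsection \<open>Bezoutian forms\<close>

text \<open>With \<open>a i\<close> for x^i, \<open>b j\<close> for y^j and Bez(x, y) the Bezoutian
  of the polynomial f with coefficients \<open>c\<close>, this is x Bez + f(y) = y Bez + f(x). Both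
  sides are the sum of \<open>c (i + j) * a i * b j\<close> over \<open>i + j \<le> d\<close>, split
  along \<open>i = 0\<close> or along \<open>j = 0\<close>. The \<open>b j\<close> are vectors so
  that the identity serves \<open>cyclic_proj\<close> as well as \<open>bez\<close>.\<close>

lemma (in vector_space) bezout_shift:
  fixes a c :: "nat \<Rightarrow> 'a" and b :: "nat \<Rightarrow> 'b"
  shows "(\<Sum>i<d. \<Sum>j<d - i. scale (c (Suc (i + j)) * a (Suc i)) (b j))
           + scale (a 0) (\<Sum>j\<le>d. scale (c j) (b j))
       = (\<Sum>i<d. \<Sum>j<d - i. scale (c (Suc (i + j)) * a i) (b (Suc j)))
           + scale (\<Sum>i\<le>d. c i * a i) (b 0)"
proof -
  let ?T = "\<Sum>i\<le>d. \<Sum>j\<le>d - i. scale (c (i + j) * a i) (b j)"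
  have "?T = (\<Sum>j\<le>d. scale (c j * a 0) (b j))
      + (\<Sum>i<d. \<Sum>j\<le>d - Suc i. scale (c (Suc (i + j)) * a (Suc i)) (b j))"
    by (simp add: sum.atMost_shift)
  also have "(\<Sum>j\<le>d. scale (c j * a 0) (b j)) = scale (a 0) (\<Sum>j\<le>d. scale (c j) (b j))"
    by (simp add: scale_sum_right mult.commute)
  also have "(\<Sum>i<d. \<Sum>j\<le>d - Suc i. scale (c (Suc (i + j)) * a (Suc i)) (b j))
      = (\<Sum>i<d. \<Sum>j<d - i. scale (c (Suc (i + j)) * a (Suc i)) (b j))"
    by (intro sum.cong refl) auto
  finally have 1: "?T = scale (a 0) (\<Sum>j\<le>d. scale (c j) (b j))
      + (\<Sum>i<d. \<Sum>j<d - i. scale (c (Suc (i + j)) * a (Suc i)) (b j))" .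
  have "?T = (\<Sum>i\<le>d. scale (c i * a i) (b 0)
      + (\<Sum>j<d - i. scale (c (Suc (i + j)) * a i) (b (Suc j))))"
    by (simp add: sum.atMost_shift)
  also have "\<dots> = scale (\<Sum>i\<le>d. c i * a i) (b 0)
      + (\<Sum>i\<le>d. \<Sum>j<d - i. scale (c (Suc (i + j)) * a i) (b (Suc j)))"
    by (simp add: sum.distrib scale_sum_left)
  also have "(\<Sum>i\<le>d. \<Sum>j<d - i. scale (c (Suc (i + j)) * a i) (b (Suc j)))
      = (\<Sum>i<d. \<Sum>j<d - i. scale (c (Suc (i + j)) * a i) (b (Suc j)))"
    by (simp add: lessThan_Suc_atMost[symmetric])
  finally show ?thesis using 1 by (simp add: add.commute)
qed

lemma sum_triangle_swap:
  fixes d :: nat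
  shows "(\<Sum>i<d. \<Sum>j<d - i. F i j) = (\<Sum>j<d. \<Sum>i<d - j. F i j)"
proof -
  have "(\<Sum>i<d. \<Sum>j<d - i. F i j) = (\<Sum>i<d. sum (F i) {j\<in>{..<d}. i + j < d})"
    by (intro sum.cong refl) auto
  also have "\<dots> = (\<Sum>j<d. \<Sum>i\<in>{i\<in>{..<d}. i + j < d}. F i j)"
    by (rule sum.swap_restrict) auto
  also have "\<dots> = (\<Sum>j<d. \<Sum>i<d - j. F i j)"
    by (intro sum.cong refl) auto
  finally show ?thesis .
qed

context linear_operator
begin

lemma functional_simps:
  assumes "functional \<phi>"
  shows "\<phi> (u + w) = \<phi> u + \<phi> w" "\<phi> (u - w) = \<phi> u - \<phi> w" "\<phi> (c *\<^sub>S u) = c * \<phi> u" "\<phi> 0 = 0"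
    "\<phi> (sum h I) = (\<Sum>i\<in>I. \<phi> (h i))"
  using assms by (simp_all add: dual.linear_add dual.linear_diff dual.linear_scale dual.linear_0
   dual.linear_sum)

lemma functionalI:
  assumes "\<And>u w. \<phi> (u + w) = \<phi> u + \<phi> w" "\<And>c u. \<phi> (c *\<^sub>S u) = c * \<phi> u"
  shows "functional \<phi>"
  using assms by (simp add: Vector_Spaces.linear_iff vector_space_axioms
      vector_space_over_itself.vector_space_axioms)

lemma functional_act:
  assumes "functional \<phi>"
  shows "\<phi> (act f u) = (\<Sum>i\<le>degree f. coeff f i * \<phi> ((A ^^ i) u))"
  by (simp add: act_def functional_simps[OF assms])

lemma functional_pow:
  assumes "functional \<phi>"
  shows "functional (\<lambda>u. \<phi> ((A ^^ n) u))"
  by (intro functionalI) (simp_all add: functional_simps[OF assms] pow_simps)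

lemma pow_A: "(A ^^ n) (A u) = (A ^^ Suc n) u"
  by (simp add: funpow_swap1)

text \<open>The coefficients are those of the Bezoutian \<open>(f(x) - f(y)) / (x - y)\<close>.\<close>

definition bez :: "'a poly \<Rightarrow> ('b \<Rightarrow> 'a) \<Rightarrow> ('b \<Rightarrow> 'a) \<Rightarrow> 'b \<Rightarrow> 'b \<Rightarrow> 'a" where
  "bez f \<phi> \<psi> u w =
     (\<Sum>i<degree f. \<Sum>j<degree f - i.
        coeff f (Suc (i + j)) * \<phi> ((A ^^ i) u) * \<psi> ((A ^^ j) w))"

text \<open>This is \<open>bez\<close> with the vectors \<open>(A ^^ j) v\<close> in place of the
  scalars \<open>\<psi> ((A ^^ j) w)\<close>. If \<open>f\<close> is the monic order of
  \<open>v\<close> and \<phi> reads off the top coefficient, it projects onto the cyclic subspace of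
  \<open>v\<close>, without any choice of a complement.\<close>

definition cyclic_proj :: "'a poly \<Rightarrow> ('b \<Rightarrow> 'a) \<Rightarrow> 'b \<Rightarrow> 'b \<Rightarrow> 'b" where
  "cyclic_proj f \<phi> v u =
     (\<Sum>i<degree f. \<Sum>j<degree f - i. (coeff f (Suc (i + j)) * \<phi> ((A ^^ i) u)) *\<^sub>S (A ^^ j) v)"

lemma bez_commute: "bez f \<phi> \<psi> u w = bez f \<psi> \<phi> w u"
proof -
  have "coeff f (Suc (i + j)) * \<phi> ((A ^^ i) u) * \<psi> ((A ^^ j) w)
      = coeff f (Suc (j + i)) * \<psi> ((A ^^ j) w) * \<phi> ((A ^^ i) u)" for i j
    by (simp add: add.commute[of i j])
  thus ?thesis
    unfolding bez_def
    using sum_triangle_swap[of "\<lambda>i j. coeff f (Suc (i + j)) * \<phi> ((A ^^ i) u) * \<psi> ((A ^^ j) w)"]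
    by presburger
qed

lemma functional_bez:
  assumes "functional \<psi>"
  shows "functional (bez f \<phi> \<psi> u)"
proof (rule functionalI)
  show "bez f \<phi> \<psi> u (x + y) = bez f \<phi> \<psi> u x + bez f \<phi> \<psi> u y" for x y
    by (simp only: bez_def functional_simps[OF assms] pow_simps distrib_left sum.distrib)
  show "bez f \<phi> \<psi> u (c *\<^sub>S x) = c * bez f \<phi> \<psi> u x" for c x
    by (simp only: bez_def functional_simps[OF assms] pow_simps sum_distrib_left mult.left_commute)
qed

text \<open>The boundary terms of \<open>bezout_shift\<close> are the two scalars assumed to vanish.
  Asking this of \<phi> and \<psi> only, not of \<open>act f\<close>, later allows \<open>f\<close>
  to be a power of x although \<open>A\<close> need not be nilpotent.\<close>

lemma bez_adjoint:
  assumes "functional \<phi>" "functional \<psi>" "\<phi> (act f u) = 0" "\<psi> (act f w) = 0"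
  shows "bez f \<phi> \<psi> (A u) w = bez f \<phi> \<psi> u (A w)"
  using vector_space_over_itself.bezout_shift[of "coeff f" "\<lambda>i. \<phi> ((A ^^ i) u)" "\<lambda>j. \<psi> ((A ^^ j) w)" "degree f"]
    assms(3,4)
  by (simp add: bez_def pow_A functional_act[OF assms(1)] functional_act[OF assms(2)] del: funpow.simps)

lemma operator_cyclic_proj:
  assumes "functional \<phi>"
  shows "operator (cyclic_proj f \<phi> v)"
proof -
  have "cyclic_proj f \<phi> v (x + y) = cyclic_proj f \<phi> v x + cyclic_proj f \<phi> v y" for x y
    by (simp only: cyclic_proj_def functional_simps[OF assms] pow_simps distrib_left
        scale_left_distrib sum.distrib)
  moreover have "cyclic_proj f \<phi> v (c *\<^sub>S x) = c *\<^sub>S cyclic_proj f \<phi> v x" for c x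
    by (simp only: cyclic_proj_def functional_simps[OF assms] pow_simps scale_sum_right
        scale_scale mult.left_commute)
  ultimately show ?thesis by (simp add: Vector_Spaces.linear_iff vector_space_axioms)
qed

lemma cyclic_proj_A:
  assumes "functional \<phi>" "\<phi> (act f u) = 0" "act f v = 0"
  shows "cyclic_proj f \<phi> v (A u) = A (cyclic_proj f \<phi> v u)"
  using bezout_shift[of "coeff f" "\<lambda>i. \<phi> ((A ^^ i) u)" "\<lambda>j. (A ^^ j) v" "degree f"]
    assms(2)[unfolded functional_act[OF assms(1)]] assms(3)[unfolded act_def]
  by (simp add: cyclic_proj_def pow_A A_simps)

lemma functional_cyclic_proj:
  assumes "functional \<psi>"
  shows "\<psi> (cyclic_proj f \<phi> v u) = bez f \<phi> \<psi> u v"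
  by (simp add: cyclic_proj_def bez_def functional_simps[OF assms])

lemma cyclic_proj_in:
  assumes "subspace W" "\<And>j. (A ^^ j) v \<in> W"
  shows "cyclic_proj f \<phi> v u \<in> W"
  unfolding cyclic_proj_def by (intro subspace_sum subspace_scale assms)

text \<open>The powers \<open>(A ^^ i) v\<close> below \<open>degree f\<close> are independent
  because \<open>f\<close> is the order of \<open>v\<close>; the functional is the coefficient of
  the top one, which turns the quotient by \<open>f\<close> into a Frobenius algebra.\<close>

lemma exists_top_functional:
  assumes "is_order f v" "lead_coeff f = 1" "degree f > 0"
  obtains \<phi> where "functional \<phi>"
    "\<And>i. i < degree f \<Longrightarrow> \<phi> ((A ^^ i) v) = (if i = degree f - 1 then 1 else 0)"
proof -
  let ?d = "degree f"
  let ?S = "{act q v |q. \<forall>i\<ge>?d - 1. coeff q i = 0}"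
  have "subspace ?S"
    unfolding subspace_def
  proof (intro conjI ballI allI)
    show "0 \<in> ?S" by (auto intro!: exI[of _ 0])
  next
    fix x y assume "x \<in> ?S" "y \<in> ?S"
    then obtain p q where "x = act p v" "y = act q v" "\<forall>i\<ge>?d - 1. coeff p i = 0"
      "\<forall>i\<ge>?d - 1. coeff q i = 0" by blast
    hence "x + y = act (p + q) v \<and> (\<forall>i\<ge>?d - 1. coeff (p + q) i = 0)" by (simp add: act_add)
    thus "x + y \<in> ?S" by blast
  next
    fix c x assume "x \<in> ?S"
    then obtain p where "x = act p v" "\<forall>i\<ge>?d - 1. coeff p i = 0" by blast
    hence "c *\<^sub>S x = act (Polynomial.smult c p) v \<and> (\<forall>i\<ge>?d - 1. coeff (Polynomial.smult c p) i = 0)"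
      by (simp add: act_smult)
    thus "c *\<^sub>S x \<in> ?S" by blast
  qed
  moreover have "(A ^^ (?d - 1)) v \<notin> ?S"
  proof
    assume "(A ^^ (?d - 1)) v \<in> ?S"
    then obtain q where q: "(A ^^ (?d - 1)) v = act q v" "\<forall>i\<ge>?d - 1. coeff q i = 0" by blast
    let ?r = "monom 1 (?d - 1) - q"
    have "act ?r v = 0" using q(1) by (simp add: act_minus act_pow)
    hence "f dvd ?r" using assms(1) by (simp add: is_order_def)
    moreover have "coeff ?r (?d - 1) \<noteq> 0" using q(2) by simp
    hence "?r \<noteq> 0" by auto
    ultimately have "degree f \<le> degree ?r" by (rule dvd_imp_degree_le)
    moreover have "degree ?r \<le> ?d - 1" using q(2) by (intro degree_le) auto
    ultimately show False using assms(3) by linarith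
  qed
  ultimately obtain \<phi> where phi: "functional \<phi>" "\<And>s. s \<in> ?S \<Longrightarrow> \<phi> s = 0"
    "\<phi> ((A ^^ (?d - 1)) v) = 1"
    using exists_functional by blast
  have "\<phi> ((A ^^ i) v) = 0" if "i < ?d" "i \<noteq> ?d - 1" for i
  proof (rule phi(2))
    have "(A ^^ i) v = act (monom 1 i) v \<and> (\<forall>k\<ge>?d - 1. coeff (monom (1::'a) i) k = 0)"
      using that by (auto simp: act_pow)
    thus "(A ^^ i) v \<in> ?S" by blast
  qed
  thus ?thesis using that phi(1,3) by auto
qed

section \<open>Self-adjoint forms on an invariant subspace\<close>

definition symmetric_form :: "('b \<Rightarrow> 'b \<Rightarrow> 'a) \<Rightarrow> bool" where
  "symmetric_form \<beta> \<longleftrightarrow> (\<forall>u. functional (\<beta> u)) \<and> (\<forall>u w. \<beta> u w = \<beta> w u)"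

definition self_adjoint_on :: "'b set \<Rightarrow> ('b \<Rightarrow> 'b) \<Rightarrow> ('b \<Rightarrow> 'b \<Rightarrow> 'a) \<Rightarrow> bool" where
  "self_adjoint_on U C \<beta> \<longleftrightarrow> (\<forall>u\<in>U. \<forall>w\<in>U. \<beta> (C u) w = \<beta> u (C w))"

definition nondegenerate_on :: "'b set \<Rightarrow> ('b \<Rightarrow> 'b \<Rightarrow> 'a) \<Rightarrow> bool" where
  "nondegenerate_on U \<beta> \<longleftrightarrow> (\<forall>u\<in>U. (\<forall>w\<in>U. \<beta> u w = 0) \<longrightarrow> u = 0)"

lemma self_adjoint_pow:
  assumes "fd_invariant U" "self_adjoint_on U A \<beta>" "u \<in> U" "w \<in> U"
  shows "\<beta> ((A ^^ n) u) w = \<beta> u ((A ^^ n) w)"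
  using assms(3,4)
proof (induction n arbitrary: w)
  case (Suc n)
  have "\<beta> ((A ^^ Suc n) u) w = \<beta> ((A ^^ n) u) (A w)"
    using assms(2) Suc.prems pow_in[OF assms(1)] by (simp add: self_adjoint_on_def)
  also have "\<dots> = \<beta> u ((A ^^ n) (A w))"
    using Suc.IH Suc.prems assms(1) by (simp add: fd_invariant_def)
  finally show ?case by (simp only: pow_A)
qed simp

text \<open>A vector of maximal order spans a cyclic subspace on which the Bezoutian form of the
  minimal polynomial is nondegenerate, and the kernel of \<open>cyclic_proj\<close> is an invariant complement.\<close>

theorem exists_self_adjoint_form:
  assumes "fd_invariant U"
  shows "\<exists>\<beta>. symmetric_form \<beta> \<and> self_adjoint_on U A \<beta> \<and> nondegenerate_on U \<beta>"
  using assms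
proof (induction "dim U" arbitrary: U rule: less_induct)
  case less
  note U = less.prems
  have subU: "subspace U" using U by (simp add: fd_invariant_def)
  show ?case
  proof (cases "U \<subseteq> {0}")
    case True
    have "symmetric_form (\<lambda>_ _. 0)" by (auto simp: symmetric_form_def intro!: functionalI)
    thus ?thesis using True
      by (intro exI[of _ "\<lambda>_ _. 0"]) (auto simp: self_adjoint_on_def nondegenerate_on_def)
  next
    case False
    obtain v f where v: "v \<in> U" "is_order f v" "lead_coeff f = 1" "\<And>u. u \<in> U \<Longrightarrow> act f u = 0"
      using exists_vector_of_maximal_order[OF U] by blast
    let ?d = "degree f"
    have d: "?d > 0"
    proof (rule ccontr)
      assume "\<not> ?d > 0"
      hence "is_unit f" using v(3) is_unit_iff_degree[of f] by force
      hence "act 1 u = 0" if "u \<in> U" for u using v(4)[OF that] act_dvd_0 by blast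
      thus False using False by auto
    qed
    obtain \<phi> where phi: "functional \<phi>"
      "\<And>i. i < ?d \<Longrightarrow> \<phi> ((A ^^ i) v) = (if i = ?d - 1 then 1 else 0)"
      using exists_top_functional[OF v(2,3) d] by blast
    let ?b = "bez f \<phi> \<phi>" and ?\<pi> = "cyclic_proj f \<phi> v"
    have lin_pi: "operator ?\<pi>" by (rule operator_cyclic_proj[OF phi(1)])
    note pi_simps = endo.linear_add[OF lin_pi] endo.linear_diff[OF lin_pi]
      endo.linear_scale[OF lin_pi] endo.linear_0[OF lin_pi]
    have phi_f: "\<phi> (act f u) = 0" if "u \<in> U" for u using v(4)[OF that] functional_simps(4)[OF phi(1)] by simp
    have pi_A: "?\<pi> (A u) = A (?\<pi> u)" if "u \<in> U" for u
      by (rule cyclic_proj_A[OF phi(1) phi_f[OF that] v(4)[OF v(1)]])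
    have pi_pow: "?\<pi> ((A ^^ n) u) = (A ^^ n) (?\<pi> u)" if "u \<in> U" for u n
      by (induction n) (simp_all add: pi_A pow_in[OF U that])
    have pi_in: "?\<pi> u \<in> U" for u by (rule cyclic_proj_in[OF subU pow_in[OF U v(1)]])
    \<comment> \<open>Evaluating \<phi> on \<open>(A ^^ j) v\<close> leaves only
      \<open>j = ?d - 1\<close>, which forces \<open>i = 0\<close>; the surviving coefficient is the
      leading one.\<close>
    have b_v: "?b x v = \<phi> x" for x
    proof -
      have "?b x v = (\<Sum>i<?d. \<Sum>j<?d - i.
          if j = ?d - 1 then coeff f (Suc (i + j)) * \<phi> ((A ^^ i) x) else 0)"
        unfolding bez_def by (intro sum.cong refl) (use phi(2) in auto)
      also have "\<dots> = (\<Sum>i<?d. if i = 0 then \<phi> x else 0)"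
        by (intro sum.cong refl) (use v(3) d in \<open>auto simp: sum.delta\<close>)
      finally show ?thesis using d by simp
    qed
    have pi_v: "?\<pi> v = v"
    proof -
      have "?\<pi> v = (\<Sum>i<?d. if i = ?d - 1 then v else 0)"
        unfolding cyclic_proj_def
      proof (intro sum.cong refl)
        fix i assume "i \<in> {..<?d}"
        thus "(\<Sum>j<?d - i. (coeff f (Suc (i + j)) * \<phi> ((A ^^ i) v)) *\<^sub>S (A ^^ j) v)
            = (if i = ?d - 1 then v else 0)"
          using phi(2)[of i] v(3) d by (cases "i = ?d - 1") auto
      qed
      thus ?thesis using d by simp
    qed
    \<comment> \<open>The image of \<open>?\<pi>\<close> lies in the span of the
      \<open>(A ^^ j) v\<close>, and each of these is fixed because \<open>v\<close> is.\<close>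
    have pi_pi: "?\<pi> (?\<pi> u) = ?\<pi> u" for u
    proof -
      have "subspace {x \<in> U. ?\<pi> x = x}"
        using subU by (auto simp: subspace_def pi_simps)
      moreover have "(A ^^ j) v \<in> {x \<in> U. ?\<pi> x = x}" for j
        using pow_in[OF U v(1)] pi_pow[OF v(1)] pi_v by simp
      ultimately show ?thesis using cyclic_proj_in by blast
    qed
    have b_pow: "?b x ((A ^^ k) v) = \<phi> ((A ^^ k) x)" if "x \<in> U" for x k
    proof -
      have "self_adjoint_on U A ?b"
        using bez_adjoint[OF phi(1) phi(1) phi_f phi_f] by (simp add: self_adjoint_on_def)
      from self_adjoint_pow[OF U this that v(1), of k] show ?thesis by (simp add: b_v)
    qed
    let ?U' = "{u \<in> U. ?\<pi> u = 0}"
    have subU': "subspace ?U'" using subU by (auto simp: subspace_def pi_simps)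
    have invU': "A u \<in> ?U'" if "u \<in> ?U'" for u
      using that U by (auto simp: fd_invariant_def pi_A A_simps)
    have v0: "v \<noteq> 0"
    proof
      assume "v = 0"
      hence "f dvd 1" using v(2) by (simp add: is_order_def act_simps)
      thus False using d is_unit_iff_degree[of f] by force
    qed
    obtain T where T: "finite T" "U \<subseteq> span T" using U by (auto simp: fd_invariant_def)
    have U': "fd_invariant ?U'" using subU' invU' T by (auto simp: fd_invariant_def)
    have "dim ?U' < dim U"
    proof -
      obtain B where B: "B \<subseteq> ?U'" "independent B" "?U' \<subseteq> span B" "card B = dim ?U'"
        using basis_exists by blast
      have "v \<notin> span B"
      proof
        assume "v \<in> span B"
        hence "v \<in> ?U'" using span_minimal[OF B(1) subU'] by blast
        thus False using pi_v v0 by simp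
      qed
      hence ind: "independent (insert v B)" "v \<notin> B" using B(2) independent_insertI span_base by blast+
      obtain C where C: "C \<subseteq> U" "independent C" "U \<subseteq> span C" "card C = dim U"
        using basis_exists by blast
      have finC: "finite C" using independent_span_bound[OF T(1) C(2)] C(1) T(2) by blast
      have "insert v B \<subseteq> span C" using v(1) B(1) C(3) by blast
      hence "finite (insert v B) \<and> card (insert v B) \<le> card C"
        by (rule independent_span_bound[OF finC ind(1)])
      moreover from this ind(2) have "card (insert v B) = Suc (card B)" by simp
      ultimately show ?thesis using B(4) C(4) by linarith
    qed
    then obtain \<beta> where beta: "symmetric_form \<beta>" "self_adjoint_on ?U' A \<beta>" "nondegenerate_on ?U' \<beta>"
      using less.hyps[OF _ U'] by blast
    note beta_simps = functional_simps[OF spec[OF conjunct1[OF beta(1)[unfolded symmetric_form_def]]]]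
    have beta_comm: "\<beta> x y = \<beta> y x" for x y using beta(1) by (simp add: symmetric_form_def)
    \<comment> \<open>The form \<beta> is controlled on \<open>?U'\<close> only, so it is pulled
      back along the complementary projection, which maps \<open>U\<close> into
      \<open>?U'\<close>.\<close>
    define \<gamma> where "\<gamma> x y = ?b x y + \<beta> (x - ?\<pi> x) (y - ?\<pi> y)" for x y
    have compl: "x - ?\<pi> x \<in> ?U'" if "x \<in> U" for x
      using that pi_in subU by (auto simp: pi_simps pi_pi subspace_diff)
    have "functional (\<gamma> x)" for x
    proof (rule functionalI)
      show "\<gamma> x (u + w) = \<gamma> x u + \<gamma> x w" for u w
        by (simp add: \<gamma>_def pi_simps beta_simps functional_simps[OF functional_bez[OF phi(1)]])
      show "\<gamma> x (c *\<^sub>S u) = c * \<gamma> x u" for c u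
        by (simp add: \<gamma>_def pi_simps beta_simps functional_simps[OF functional_bez[OF phi(1)]]
            distrib_left right_diff_distrib)
    qed
    moreover have "\<gamma> x y = \<gamma> y x" for x y
      using bez_commute[of f \<phi> \<phi> x y] beta_comm[of "x - ?\<pi> x"] by (simp add: \<gamma>_def)
    ultimately have "symmetric_form \<gamma>" by (simp add: symmetric_form_def)
    moreover have "self_adjoint_on U A \<gamma>"
      unfolding self_adjoint_on_def
    proof (intro ballI)
      fix x y assume xy: "x \<in> U" "y \<in> U"
      have "A x - ?\<pi> (A x) = A (x - ?\<pi> x)" "A y - ?\<pi> (A y) = A (y - ?\<pi> y)"
        using xy by (simp_all add: pi_A A_simps)
      thus "\<gamma> (A x) y = \<gamma> x (A y)"
        using beta(2) compl[OF xy(1)] compl[OF xy(2)] bez_adjoint[OF phi(1) phi(1) phi_f[OF xy(1)] phi_f[OF xy(2)]]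
        by (simp add: \<gamma>_def self_adjoint_on_def)
    qed
    moreover have "nondegenerate_on U \<gamma>"
      unfolding nondegenerate_on_def
    proof (intro ballI impI)
      fix x assume x: "x \<in> U" "\<forall>w\<in>U. \<gamma> x w = 0"
      have "\<beta> (x - ?\<pi> x) w = 0" if w: "w \<in> ?U'" for w
      proof -
        \<comment> \<open>Composing \<phi> with \<open>?\<pi>\<close> gives \<phi> back, so \<phi>
          vanishes on the \<open>A\<close>-invariant kernel of \<open>?\<pi>\<close>, which makes
          \<open>w\<close> orthogonal to everything for \<open>?b\<close>.\<close>
        have "\<phi> ((A ^^ j) w) = 0" for j
        proof -
          have "(A ^^ j) w \<in> ?U'" using pow_in[OF U'] w by blast
          hence "\<phi> (?\<pi> ((A ^^ j) w)) = 0" using functional_simps(4)[OF phi(1)] by simp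
          thus ?thesis using b_v functional_cyclic_proj[OF phi(1)] by simp
        qed
        hence "?b x w = 0" by (simp add: bez_def)
        moreover have "\<gamma> x w = 0" "?\<pi> w = 0" using x(2) w by auto
        ultimately show ?thesis by (simp add: \<gamma>_def)
      qed
      hence "x - ?\<pi> x = 0" using beta(3) compl[OF x(1)] unfolding nondegenerate_on_def by blast
      hence pi_x: "?\<pi> x = x" by simp
      \<comment> \<open>Testing against \<open>(A ^^ k) v\<close>, which \<open>?\<pi>\<close>
        fixes, leaves only the Bezoutian term; these scalars are all that \<open>?\<pi> x\<close> is
        built from.\<close>
      have "\<phi> ((A ^^ k) x) = 0" for k
      proof -
        have "(A ^^ k) v \<in> U" by (rule pow_in[OF U v(1)])
        hence "\<gamma> x ((A ^^ k) v) = 0" using x(2) by blast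
        moreover have "?\<pi> ((A ^^ k) v) = (A ^^ k) v" using pi_pow[OF v(1)] pi_v by simp
        ultimately show ?thesis using b_pow[OF x(1)] by (simp add: \<gamma>_def beta_simps)
      qed
      hence "?\<pi> x = 0" by (simp add: cyclic_proj_def)
      thus "x = 0" using pi_x by simp
    qed
    ultimately show ?thesis by blast
  qed
qed

end

subsection \<open>Pairs of operators annihilating each other\<close>

text \<open>The equation is the symmetry condition and the inequality the determinant of the pairing
  of \<open>ker A\<close> with the cokernel. The witnesses are explicit because the field may have
  only two elements, which rules out a genericity argument.\<close>

lemma exists_symmetrizing_scalars:
  fixes b11 b12 b21 b22 c :: "'a::field"
  assumes "b11 * b22 - b12 * b21 \<noteq> 0" "c = 0 \<or> c = 1"
  obtains \<alpha> \<delta> \<sigma> where "b11 * (c * \<sigma>) + b12 * \<delta> = b21 * \<alpha> + b22 * \<sigma>"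
    "\<alpha> * \<delta> - c * \<sigma> * \<sigma> \<noteq> 0"
proof -
  consider "b12 = 0" "b21 = 0" | "b12 \<noteq> 0" "b21 \<noteq> 0" | "b12 = 0" "b21 \<noteq> 0" "c = 1"
    | "b12 \<noteq> 0" "b21 = 0" "c = 1" | "b12 = 0 \<or> b21 = 0" "c = 0"
    using assms(2) by blast
  thus ?thesis
  proof cases
    case 1
    \<comment> \<open>Here and below the arguments of \<open>that\<close> are \<sigma>, \<delta>,
      \<alpha>, in their order of occurrence in the equation.\<close>
    thus ?thesis using that[of 0 1 1] by simp
  next
    case 2
    thus ?thesis using that[of 0 b21 b12] by simp
  next
    case 3
    thus ?thesis using that[of 1 0 "(b11 - b22) / b21"] by simp
  next
    case 4
    thus ?thesis using that[of 1 "(b22 - b11) / b12" 0] by simp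
  next
    case 5
    hence "b22 \<noteq> 0" using assms(1) by auto
    thus ?thesis using that[of "(b12 - b21) / b22" 1 1] 5 by simp
  qed
qed

context linear_operator
begin

section \<open>The kernel and the images of powers\<close>

lemma subspace_image_pow: "subspace V \<Longrightarrow> subspace ((A ^^ n) ` V)"
  by (rule endo.linear_subspace_image[OF linear_pow])

lemma image_pow_decreasing:
  assumes "fd_invariant V" "m \<le> n"
  shows "(A ^^ n) ` V \<subseteq> (A ^^ m) ` V"
proof
  fix x assume "x \<in> (A ^^ n) ` V"
  then obtain u where u: "u \<in> V" "x = (A ^^ n) u" by blast
  have "x = (A ^^ m) ((A ^^ (n - m)) u)"
    using u(2) assms(2) by (metis comp_apply funpow_add le_add_diff_inverse)
  thus "x \<in> (A ^^ m) ` V" using pow_in[OF assms(1) u(1)] by blast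
qed

lemma act_kernel: "A z = 0 \<Longrightarrow> act g z = coeff g 0 *\<^sub>S z"
  by (induction g) (simp_all add: act_pCons A_simps)

text \<open>Half of Fitting's lemma. Split an annihilating \<open>f\<close> as x^n g with g(0)
  nonzero: \<open>act g\<close> kills \<open>(A ^^ n) u\<close>, but on the kernel of
  \<open>A\<close> it is multiplication by g(0).\<close>

lemma kernel_image_pow_disjoint:
  assumes "fd_invariant V"
  obtains n where "\<And>u. u \<in> V \<Longrightarrow> A ((A ^^ n) u) = 0 \<Longrightarrow> (A ^^ n) u = 0"
proof -
  obtain v f where f: "is_order f v" "\<And>u. u \<in> V \<Longrightarrow> act f u = 0"
    using exists_vector_of_maximal_order[OF assms] by metis
  have "f \<noteq> 0" using f(1) by (simp add: is_order_def)
  then obtain n g where g: "f = [:0, 1:] ^ n * g" "\<not> [:0, 1:] dvd g"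
    using factor_out_power_poly[of f "[:0, 1:]"] by auto
  have g0: "coeff g 0 \<noteq> 0" using g(2) poly_eq_0_iff_dvd[of g 0] by (simp add: poly_0_coeff_0)
  have "(A ^^ n) u = 0" if u: "u \<in> V" "A ((A ^^ n) u) = 0" for u
  proof -
    have "f = g * monom 1 n" using g(1) by (simp add: monom_altdef mult.commute)
    hence "act g ((A ^^ n) u) = 0" using f(2)[OF u(1)] by (simp add: act_mult act_pow)
    thus ?thesis using act_kernel[OF u(2)] g0 by simp
  qed
  thus ?thesis using that by blast
qed

text \<open>\<open>a\<close> and \<open>b\<close> are the sizes of the nilpotent Jordan blocks
  generated by \<open>v1\<close> and \<open>v2\<close>. They are read off from how
  \<open>ker A\<close> meets the image of \<open>A ^^ i\<close>: in all of \<open>ker A\<close> for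
  \<open>i < b\<close>, in a line for \<open>b \<le> i < a\<close>, trivially from \<open>a\<close>
  on. The functionals vanish on the images of \<open>A ^^ a\<close> and \<open>A ^^ b\<close> so
  that \<open>bez_adjoint\<close> applies to x^a and x^b; their other values make the block forms
  diagonal on the kernel basis against \<open>v1\<close>, \<open>v2\<close>.\<close>

lemma exists_kernel_coordinates:
  assumes V: "fd_invariant V" and K: "dim {u \<in> V. A u = 0} = 2"
  obtains b a v1 v2 \<phi>1 \<phi>2 where
    "0 < b" "b \<le> a" "v1 \<in> V" "v2 \<in> V" "functional \<phi>1" "functional \<phi>2"
    "A ((A ^^ (a - 1)) v1) = 0" "A ((A ^^ (b - 1)) v2) = 0"
    "\<And>z. z \<in> V \<Longrightarrow> A z = 0 \<Longrightarrow> \<exists>x y. z = x *\<^sub>S (A ^^ (a - 1)) v1 + y *\<^sub>S (A ^^ (b - 1)) v2"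
    "\<And>u. u \<in> V \<Longrightarrow> \<phi>1 ((A ^^ a) u) = 0" "\<And>u. u \<in> V \<Longrightarrow> \<phi>2 ((A ^^ b) u) = 0"
    "\<phi>1 ((A ^^ (a - 1)) v1) = 1" "\<phi>1 ((A ^^ (b - 1)) v2) = 0"
    "\<phi>2 ((A ^^ (b - 1)) v2) = 1" "\<phi>2 ((A ^^ (a - 1)) v1) = 0" "\<phi>2 ((A ^^ (b - 1)) v1) = 0"
proof -
  let ?K = "{u \<in> V. A u = 0}" and ?I = "\<lambda>i. (A ^^ i) ` V"
  have subV: "subspace V" using V by (simp add: fd_invariant_def)
  have subK: "subspace ?K" using subV by (auto simp: subspace_def A_simps)
  have subI: "subspace (?I i)" for i by (rule subspace_image_pow[OF subV])
  obtain C where C: "C \<subseteq> ?K" "independent C" "?K \<subseteq> span C" "card C = 2"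
    by (rule basis_exists[of ?K]) (use K in simp)
  have finC: "finite C" using C(4) by (metis card.infinite zero_neq_numeral)
  have K_not_line: "\<exists>z\<in>?K. z \<notin> span {y}" for y
  proof (rule ccontr)
    assume "\<not> (\<exists>z\<in>?K. z \<notin> span {y})"
    hence "C \<subseteq> span {y}" using C(1) by blast
    hence "card C \<le> card {y}" using independent_span_bound[of "{y}" C] C(2) by simp
    thus False using C(4) by simp
  qed
  have K_nz: "\<not> ?K \<subseteq> {0}" using K_not_line[of 0] by (auto simp: span_zero)
  obtain n where "\<And>u. u \<in> V \<Longrightarrow> A ((A ^^ n) u) = 0 \<Longrightarrow> (A ^^ n) u = 0"
    using kernel_image_pow_disjoint[OF V] by blast
  hence n: "?K \<inter> ?I n \<subseteq> {0}" by auto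
  define a where "a = (LEAST i. ?K \<inter> ?I i \<subseteq> {0})"
  define b where "b = (LEAST i. \<not> ?K \<subseteq> ?I i)"
  have a: "?K \<inter> ?I a \<subseteq> {0}" unfolding a_def by (rule LeastI[of "\<lambda>i. ?K \<inter> ?I i \<subseteq> {0}", OF n])
  have a_min: "\<not> ?K \<inter> ?I i \<subseteq> {0}" if "i < a" for i
    using not_less_Least[of i "\<lambda>i. ?K \<inter> ?I i \<subseteq> {0}"] that by (simp add: a_def)
  have nKa: "\<not> ?K \<subseteq> ?I a" using a K_nz by blast
  have b: "\<not> ?K \<subseteq> ?I b" unfolding b_def by (rule LeastI[of "\<lambda>i. \<not> ?K \<subseteq> ?I i", OF nKa])
  have b_min: "?K \<subseteq> ?I i" if "i < b" for i
    using not_less_Least[of i "\<lambda>i. \<not> ?K \<subseteq> ?I i"] that by (simp add: b_def)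
  have ba: "b \<le> a" unfolding b_def by (rule Least_le) (rule nKa)
  have b0: "0 < b" using b by (intro gr0I) auto
  have "\<not> ?K \<inter> ?I (a - 1) \<subseteq> {0}" using a_min[of "a - 1"] b0 ba by linarith
  then obtain z1 where z1: "z1 \<in> ?K" "z1 \<in> ?I (a - 1)" "z1 \<noteq> 0" by blast
  \<comment> \<open>If \<open>b < a\<close>, the line of \<open>z1\<close> lies in
    \<open>?I b\<close>, so avoiding \<open>?I b\<close> already gives independence;
    \<open>n2\<close> needs the stronger property.\<close>
  have "\<exists>z2\<in>?K. z2 \<notin> span {z1} \<and> (b < a \<longrightarrow> z2 \<notin> ?I b)"
  proof (cases "b < a")
    case True
    hence "?I (a - 1) \<subseteq> ?I b" by (intro image_pow_decreasing[OF V]) simp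
    hence "{z1} \<subseteq> ?I b" using z1(2) by blast
    hence "span {z1} \<subseteq> ?I b" by (rule span_minimal[OF _ subI])
    moreover obtain z2 where "z2 \<in> ?K" "z2 \<notin> ?I b" using b by blast
    ultimately show ?thesis by blast
  qed (use K_not_line[of z1] in blast)
  then obtain z2 where z2: "z2 \<in> ?K" "z2 \<notin> span {z1}" "b < a \<Longrightarrow> z2 \<notin> ?I b" by blast
  have "z2 \<in> ?I (b - 1)" using b_min[of "b - 1"] b0 z2(1) by auto
  then obtain v1 v2 where v: "v1 \<in> V" "z1 = (A ^^ (a - 1)) v1" "v2 \<in> V" "z2 = (A ^^ (b - 1)) v2"
    using z1(2) by blast
  have Az: "A z1 = 0" "A z2 = 0" using z1(1) z2(1) by auto
  have span_K: "z \<in> span {z2, z1}" if z: "z \<in> ?K" for z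
  proof (rule ccontr)
    assume nz: "z \<notin> span {z2, z1}"
    have ind: "independent {z2, z1}" by (rule independent_insertI[OF z2(2)]) (simp add: z1(3))
    have "independent {z, z2, z1}" using nz ind by (rule independent_insertI)
    moreover have "{z, z2, z1} \<subseteq> span C" using z z1(1) z2(1) C(3) by blast
    ultimately have "card {z, z2, z1} \<le> card C" using independent_span_bound[OF finC] by blast
    moreover have "z \<noteq> z2" "z \<noteq> z1" "z2 \<noteq> z1" using nz z2(2) by (auto intro: span_base)
    ultimately show False using C(4) by simp
  qed
  have coords: "\<exists>x y. z = x *\<^sub>S z1 + y *\<^sub>S z2" if z: "z \<in> V" "A z = 0" for z
  proof -
    have "z \<in> span {z2, z1}" using span_K z by blast
    then obtain y where "z - y *\<^sub>S z2 \<in> span {z1}" by (auto simp: span_breakdown_eq)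
    then obtain x where "z - y *\<^sub>S z2 - x *\<^sub>S z1 = 0" by (auto simp: span_breakdown_eq)
    hence "z = x *\<^sub>S z1 + y *\<^sub>S z2" by (simp add: algebra_simps)
    thus ?thesis by blast
  qed
  have spanI: "x \<in> span (insert y (?I i)) \<Longrightarrow> \<exists>k. x - k *\<^sub>S y \<in> ?I i" for x y i
    using span_breakdown_eq[of x y "?I i"] span_eq_iff[THEN iffD2, OF subI[of i]] by metis
  have n1: "z1 \<notin> span (insert z2 (?I a))"
  proof
    assume "z1 \<in> span (insert z2 (?I a))"
    then obtain k where "z1 - k *\<^sub>S z2 \<in> ?I a" using spanI by blast
    moreover have "z1 - k *\<^sub>S z2 \<in> ?K"
      by (intro subspace_diff[OF subK] subspace_scale[OF subK] z1 z2)
    ultimately have "z1 - k *\<^sub>S z2 = 0" using a by blast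
    hence eq: "z1 = k *\<^sub>S z2" by simp
    hence "k \<noteq> 0" using z1(3) by auto
    hence "z2 = inverse k *\<^sub>S z1" using eq by simp
    thus False using z2(2) span_scale[OF span_base] by blast
  qed
  have n2: "z2 \<notin> span (insert ((A ^^ (b - 1)) v1) (?I b))"
  proof
    assume "z2 \<in> span (insert ((A ^^ (b - 1)) v1) (?I b))"
    then obtain k where k: "z2 - k *\<^sub>S (A ^^ (b - 1)) v1 \<in> ?I b" using spanI by blast
    show False
    proof (cases "b < a")
      case False
      hence ab: "b = a" using ba by simp
      have "z2 - k *\<^sub>S z1 \<in> ?K"
        by (intro subspace_diff[OF subK] subspace_scale[OF subK] z1 z2)
      hence "z2 - k *\<^sub>S z1 = 0" using a k ab v(2) by blast
      hence "z2 = k *\<^sub>S z1" by simp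
      thus False using z2(2) span_scale[OF span_base] by blast
    next
      case True
      \<comment> \<open>Apply \<open>A ^^ (a - b)\<close>: it kills \<open>z2\<close>, sends
        \<open>(A ^^ (b - 1)) v1\<close> to \<open>z1\<close> and maps \<open>?I b\<close> into
        \<open>?I a\<close>, which meets the kernel trivially. So \<open>k = 0\<close>, against the
        choice of \<open>z2\<close>.\<close>
      obtain u where u: "u \<in> V" "z2 - k *\<^sub>S (A ^^ (b - 1)) v1 = (A ^^ b) u" using k by blast
      have ab: "a - b = Suc (a - b - 1)" "a - b + (b - 1) = a - 1" "a - b + b = a"
        using True b0 by auto
      have "(A ^^ (a - b)) z2 = 0" using Az(2) by (subst ab(1)) (simp add: funpow_swap1 pow_simps)
      hence "(A ^^ (a - b)) (z2 - k *\<^sub>S (A ^^ (b - 1)) v1) = - (k *\<^sub>S z1)"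
        using v(2) ab(2) by (simp add: pow_simps funpow_add[symmetric, THEN fun_cong, simplified])
      moreover have "(A ^^ (a - b)) ((A ^^ b) u) = (A ^^ a) u"
        using ab(3) by (metis comp_apply funpow_add)
      ultimately have eq: "- (k *\<^sub>S z1) = (A ^^ a) u" using u(2) by simp
      have "k *\<^sub>S z1 \<in> ?K" by (intro subspace_scale[OF subK] z1)
      hence "- (k *\<^sub>S z1) \<in> ?K" by (rule subspace_neg[OF subK])
      hence "- (k *\<^sub>S z1) = 0" using a eq u(1) by blast
      hence "k = 0" using z1(3) by simp
      hence "z2 \<in> ?I b" using k by simp
      thus False using z2(3)[OF True] by blast
    qed
  qed
  obtain \<phi>1 where p1: "functional \<phi>1" "\<And>s. s \<in> span (insert z2 (?I a)) \<Longrightarrow> \<phi>1 s = 0" "\<phi>1 z1 = 1"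
    using exists_functional[OF subspace_span n1] by blast
  obtain \<phi>2 where p2: "functional \<phi>2"
    "\<And>s. s \<in> span (insert ((A ^^ (b - 1)) v1) (?I b)) \<Longrightarrow> \<phi>2 s = 0" "\<phi>2 z2 = 1"
    using exists_functional[OF subspace_span n2] by blast
  have "\<phi>2 z1 = 0"
  proof (rule p2(2))
    show "z1 \<in> span (insert ((A ^^ (b - 1)) v1) (?I b))"
    proof (cases "b < a")
      case True
      hence "?I (a - 1) \<subseteq> ?I b" by (intro image_pow_decreasing[OF V]) simp
      hence "z1 \<in> insert ((A ^^ (b - 1)) v1) (?I b)" using z1(2) by blast
      thus ?thesis by (rule span_base)
    next
      case False
      hence "a = b" using ba by simp
      thus ?thesis using v(2) by (simp add: span_base)
    qed
  qed
  moreover have "\<phi>1 z2 = 0" "\<phi>1 ((A ^^ a) u) = 0" if "u \<in> V" for u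
    using that by (auto intro!: p1(2) span_base)
  moreover have "\<phi>2 ((A ^^ (b - 1)) v1) = 0" "\<phi>2 ((A ^^ b) u) = 0" if "u \<in> V" for u
    using that by (auto intro!: p2(2) span_base)
  ultimately show ?thesis
    using that[of b a v1 v2 \<phi>1 \<phi>2] b0 ba v p1(1,3) p2(1,3) Az coords by metis
qed


section \<open>Forms adapted to a pair\<close>

lemma pow_kernel: "A z = 0 \<Longrightarrow> (A ^^ n) z = (if n = 0 then z else 0)"
  by (induction n) (simp_all add: A_simps)

text \<open>For x^b only \<open>i + j = b - 1\<close> contributes, and on \<open>ker A\<close> only
  \<open>i = 0\<close>; this evaluates the pairing of \<open>ker A\<close> with
  \<open>V\<close>.\<close>

lemma bez_monom_kernel:
  assumes "functional \<phi>" "A z = 0" "0 < b"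
  shows "bez (monom 1 b) \<phi> \<psi> z w = \<phi> z * \<psi> ((A ^^ (b - 1)) w)"
proof -
  have "bez (monom 1 b) \<phi> \<psi> z w
      = (\<Sum>i<b. if i = 0 then (\<Sum>j<b. if j = b - 1 then \<phi> z * \<psi> ((A ^^ j) w) else 0) else 0)"
    unfolding bez_def
  proof (rule sum.cong)
    show "{..<degree (monom (1::'a) b)} = {..<b}" by (simp add: degree_monom_eq)
    fix i assume "i \<in> {..<b}"
    show "(\<Sum>j<degree (monom (1::'a) b) - i.
          coeff (monom 1 b) (Suc (i + j)) * \<phi> ((A ^^ i) z) * \<psi> ((A ^^ j) w))
        = (if i = 0 then (\<Sum>j<b. if j = b - 1 then \<phi> z * \<psi> ((A ^^ j) w) else 0) else 0)"
    proof (cases "i = 0")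
      case True
      have "(\<Sum>j<b. coeff (monom 1 b) (Suc j) * \<phi> z * \<psi> ((A ^^ j) w))
          = (\<Sum>j<b. if j = b - 1 then \<phi> z * \<psi> ((A ^^ j) w) else 0)"
        by (intro sum.cong refl) (use assms(3) in auto)
      thus ?thesis using True by (simp add: degree_monom_eq)
    next
      case False
      thus ?thesis using functional_simps(4)[OF assms(1)] by (simp add: pow_kernel[OF assms(2)])
    qed
  qed
  thus ?thesis using assms(3) by simp
qed

definition annihilating_pair :: "'b set \<Rightarrow> ('b \<Rightarrow> 'b) \<Rightarrow> bool" where
  "annihilating_pair V B \<longleftrightarrow> fd_invariant V \<and> operator B \<and>
     (\<forall>u\<in>V. B u \<in> V \<and> A (B u) = 0 \<and> B (A u) = 0 \<and> (B u = 0 \<longrightarrow> u \<in> A ` V))"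

text \<open>Any nondegenerate form for \<open>A\<close> works. If \<open>B u = c z\<close> and
  \<open>B w = d z\<close>, then \<open>d u - c w\<close> is killed by \<open>B\<close>, hence lies
  in \<open>A V\<close>, which is orthogonal to the image of \<open>B\<close>; comparing the two
  terms gives the symmetry.\<close>

lemma exists_pair_form_dim1:
  assumes "annihilating_pair V B" "dim {u \<in> V. A u = 0} = 1"
  shows "\<exists>\<gamma>. symmetric_form \<gamma> \<and> self_adjoint_on V A \<gamma> \<and> self_adjoint_on V B \<gamma> \<and> nondegenerate_on V \<gamma>"
proof -
  have V: "fd_invariant V" and linB: "operator B"
    and BV: "\<And>u. u \<in> V \<Longrightarrow> B u \<in> V" and AB: "\<And>u. u \<in> V \<Longrightarrow> A (B u) = 0"
    and BA: "\<And>u. u \<in> V \<Longrightarrow> B (A u) = 0" and kerB: "\<And>u. u \<in> V \<Longrightarrow> B u = 0 \<Longrightarrow> u \<in> A ` V"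
    using assms(1) by (simp_all add: annihilating_pair_def)
  note B_simps = endo.linear_add[OF linB] endo.linear_diff[OF linB] endo.linear_scale[OF linB]
  have subV: "subspace V" using V by (simp add: fd_invariant_def)
  obtain \<beta> where beta: "symmetric_form \<beta>" "self_adjoint_on V A \<beta>" "nondegenerate_on V \<beta>"
    using exists_self_adjoint_form[OF V] by blast
  have fun_beta: "functional (\<beta> u)" for u using beta(1) by (simp add: symmetric_form_def)
  have beta_comm: "\<beta> u w = \<beta> w u" for u w using beta(1) by (simp add: symmetric_form_def)
  obtain C where C: "C \<subseteq> {u \<in> V. A u = 0}" "{u \<in> V. A u = 0} \<subseteq> span C" "card C = 1"
    by (rule basis_exists[of "{u \<in> V. A u = 0}"]) (use assms(2) in simp)
  then obtain z where z: "C = {z}" by (meson card_1_singletonE)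
  have line: "\<exists>c. B u = c *\<^sub>S z" if "u \<in> V" for u
  proof -
    have "B u \<in> span {z}" using C(2) z BV[OF that] AB[OF that] by auto
    thus ?thesis using span_breakdown_eq[of "B u" z "{}"] by auto
  qed
  have B_im: "\<beta> (B u) (A w) = 0" if "u \<in> V" "w \<in> V" for u w
  proof -
    have "\<beta> (B u) (A w) = \<beta> (A (B u)) w"
      using beta(2) BV[OF that(1)] that(2) by (simp add: self_adjoint_on_def)
    also have "\<dots> = \<beta> w 0" using AB[OF that(1)] by (simp add: beta_comm[of 0])
    finally show ?thesis using functional_simps(4)[OF fun_beta] by simp
  qed
  have "\<beta> (B u) w = \<beta> u (B w)" if uw: "u \<in> V" "w \<in> V" for u w
  proof -
    obtain c d where cd: "B u = c *\<^sub>S z" "B w = d *\<^sub>S z" using line uw by meson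
    have "B (d *\<^sub>S u - c *\<^sub>S w) = 0" using cd by (simp add: B_simps mult.commute)
    moreover have in_V: "d *\<^sub>S u - c *\<^sub>S w \<in> V" using uw subV by (intro subspace_diff subspace_scale)
    ultimately obtain x where x: "x \<in> V" "d *\<^sub>S u - c *\<^sub>S w = A x" using kerB by blast
    show ?thesis
    \<comment> \<open>Only the image of \<open>B\<close> is known to be orthogonal to
      \<open>A V\<close>; \<open>z\<close> inherits this once \<open>c\<close> or \<open>d\<close>
      is nonzero.\<close>
    proof (cases "c = 0 \<and> d = 0")
      case True
      thus ?thesis using cd functional_simps(4)[OF fun_beta] by (simp add: beta_comm[of 0])
    next
      case False
      have "\<beta> (B u) (A x) = 0" "\<beta> (B w) (A x) = 0" using B_im uw x(1) by auto
      hence "c * \<beta> z (d *\<^sub>S u - c *\<^sub>S w) = 0" "d * \<beta> z (d *\<^sub>S u - c *\<^sub>S w) = 0"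
        unfolding x(2) cd by (simp_all add: beta_comm[of _ "A x"] functional_simps[OF fun_beta])
      hence "\<beta> z (d *\<^sub>S u - c *\<^sub>S w) = 0" using False by auto
      hence "c * \<beta> z w = d * \<beta> z u" by (simp add: functional_simps[OF fun_beta])
      thus ?thesis unfolding cd
        by (simp add: beta_comm[of _ w] beta_comm[of _ u] functional_simps[OF fun_beta])
    qed
  qed
  thus ?thesis using beta by (auto simp: self_adjoint_on_def)
qed

text \<open>For a two-dimensional kernel the bilinear form \<open>\<gamma> (B u) w\<close> on \<open>V / A V\<close> need not be symmetric,
  so the form has to be adapted to \<open>B\<close>: the coefficients \<open>\<alpha>\<close>, \<open>\<delta>\<close>, \<open>\<sigma>\<close> are chosen to satisfy the single
  linear condition of symmetry. The last summand only serves nondegeneracy on the part of \<open>V\<close> where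
  \<open>A\<close> is invertible.\<close>

lemma exists_pair_form_dim2:
  assumes "annihilating_pair V B" "dim {u \<in> V. A u = 0} = 2"
  shows "\<exists>\<gamma>. symmetric_form \<gamma> \<and> self_adjoint_on V A \<gamma> \<and> self_adjoint_on V B \<gamma> \<and> nondegenerate_on V \<gamma>"
proof -
  have V: "fd_invariant V" and linB: "operator B"
    and BV: "\<And>u. u \<in> V \<Longrightarrow> B u \<in> V" and AB: "\<And>u. u \<in> V \<Longrightarrow> A (B u) = 0"
    and BA: "\<And>u. u \<in> V \<Longrightarrow> B (A u) = 0" and kerB: "\<And>u. u \<in> V \<Longrightarrow> B u = 0 \<Longrightarrow> u \<in> A ` V"
    using assms(1) by (simp_all add: annihilating_pair_def)
  note B_simps = endo.linear_add[OF linB] endo.linear_diff[OF linB] endo.linear_scale[OF linB]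
  have subV: "subspace V" and AV: "\<And>u. u \<in> V \<Longrightarrow> A u \<in> V" using V by (auto simp: fd_invariant_def)
  obtain \<beta> where beta: "symmetric_form \<beta>" "self_adjoint_on V A \<beta>" "nondegenerate_on V \<beta>"
    using exists_self_adjoint_form[OF V] by blast
  have fun_beta: "functional (\<beta> u)" for u using beta(1) by (simp add: symmetric_form_def)
  have beta_comm: "\<beta> u w = \<beta> w u" for u w using beta(1) by (simp add: symmetric_form_def)
  obtain b a v1 v2 \<phi>1 \<phi>2 where ab: "0 < b" "b \<le> a" and v: "v1 \<in> V" "v2 \<in> V"
    and phi: "functional \<phi>1" "functional \<phi>2"
    and Az: "A ((A ^^ (a - 1)) v1) = 0" "A ((A ^^ (b - 1)) v2) = 0"
    and ker: "\<And>z. z \<in> V \<Longrightarrow> A z = 0 \<Longrightarrow>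
      \<exists>x y. z = x *\<^sub>S (A ^^ (a - 1)) v1 + y *\<^sub>S (A ^^ (b - 1)) v2"
    and phi_im: "\<And>u. u \<in> V \<Longrightarrow> \<phi>1 ((A ^^ a) u) = 0" "\<And>u. u \<in> V \<Longrightarrow> \<phi>2 ((A ^^ b) u) = 0"
    and phi_z: "\<phi>1 ((A ^^ (a - 1)) v1) = 1" "\<phi>1 ((A ^^ (b - 1)) v2) = 0"
      "\<phi>2 ((A ^^ (b - 1)) v2) = 1" "\<phi>2 ((A ^^ (a - 1)) v1) = 0"
    and phi_v1: "\<phi>2 ((A ^^ (b - 1)) v1) = 0"
    by (rule exists_kernel_coordinates[OF V assms(2)]) (rule that; assumption)
  define z1 z2 where "z1 = (A ^^ (a - 1)) v1" and "z2 = (A ^^ (b - 1)) v2"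
  note Az = Az[folded z1_def z2_def] and ker = ker[folded z1_def z2_def]
    and phi_z = phi_z[folded z1_def z2_def]
  have zV: "z1 \<in> V" "z2 \<in> V" unfolding z1_def z2_def using v pow_in[OF V] by blast+
  \<comment> \<open>The shift makes \<phi>1 vanish on the image of \<open>A ^^ b\<close>, so that it
    can be paired with \<phi>2 in the Bezoutian of x^b.\<close>
  define \<phi>' where "\<phi>' u = \<phi>1 ((A ^^ (a - b)) u)" for u
  have phi': "functional \<phi>'" unfolding \<phi>'_def by (rule functional_pow[OF phi(1)])
  \<comment> \<open>This is \<open>\<phi>' z1\<close>: the shift kills \<open>z1\<close> unless the
    blocks have equal size.\<close>
  define c :: 'a where "c = (if a = b then 1 else 0)"
  have c01: "c = 0 \<or> c = 1" by (simp add: c_def)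
  have pow_plus: "(A ^^ m) ((A ^^ n) u) = (A ^^ (m + n)) u" for m n u by (simp add: funpow_add)
  have phi'_z: "\<phi>' z1 = c" "\<phi>' z2 = 0"
    using phi_z functional_simps(4)[OF phi(1)] ab by (auto simp: \<phi>'_def c_def pow_kernel Az)
  have phi1_v2: "\<phi>1 ((A ^^ (a - 1)) v2) = 0"
  proof -
    have "(A ^^ (a - 1)) v2 = (A ^^ (a - b)) z2" using ab by (simp add: z2_def pow_plus)
    thus ?thesis using phi'_z(2) by (simp add: \<phi>'_def)
  qed
  have phi'_pow: "\<phi>' ((A ^^ (b - 1)) w) = \<phi>1 ((A ^^ (a - 1)) w)" for w
    using ab by (simp add: \<phi>'_def pow_plus)
  have phi'_im: "\<phi>' ((A ^^ b) u) = 0" if "u \<in> V" for u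
    using ab phi_im(1)[OF that] by (simp add: \<phi>'_def pow_plus)

  \<comment> \<open>Apply \<open>A ^^ (b - 1)\<close> and \<phi>2 to isolate \<open>c2\<close>, and
    \<open>A ^^ (a - 1)\<close> and \<phi>1 to isolate \<open>c1\<close>.\<close>
  have v_indep: "c1 = 0 \<and> c2 = 0" if "c1 *\<^sub>S v1 + c2 *\<^sub>S v2 \<in> A ` V" for c1 c2
  proof -
    obtain u where u: "u \<in> V" "c1 *\<^sub>S v1 + c2 *\<^sub>S v2 = A u" using \<open>_ \<in> A ` V\<close> by blast
    have "(A ^^ (b - 1)) (A u) = (A ^^ b) u" "(A ^^ (a - 1)) (A u) = (A ^^ a) u"
      using ab pow_A[of "b - 1" u] pow_A[of "a - 1" u] by simp_all
    hence "(A ^^ b) u = c1 *\<^sub>S (A ^^ (b - 1)) v1 + c2 *\<^sub>S z2"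
      "(A ^^ a) u = c1 *\<^sub>S z1 + c2 *\<^sub>S (A ^^ (a - 1)) v2"
      unfolding u(2)[symmetric] by (simp_all add: pow_simps z1_def z2_def)
    with phi_im(2)[OF u(1)] phi_im(1)[OF u(1)] have
      "\<phi>2 (c1 *\<^sub>S (A ^^ (b - 1)) v1 + c2 *\<^sub>S z2) = 0" "\<phi>1 (c1 *\<^sub>S z1 + c2 *\<^sub>S (A ^^ (a - 1)) v2) = 0"
      by simp_all
    thus ?thesis using phi_z phi_v1 phi1_v2
      by (simp add: functional_simps[OF phi(1)] functional_simps[OF phi(2)])
  qed
  obtain b11 b12 b21 b22 where Bv: "B v1 = b11 *\<^sub>S z1 + b12 *\<^sub>S z2" "B v2 = b21 *\<^sub>S z1 + b22 *\<^sub>S z2"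
    using ker[OF BV[OF v(1)] AB[OF v(1)]] ker[OF BV[OF v(2)] AB[OF v(2)]] by blast
  have lin_v: "c1 *\<^sub>S v1 + c2 *\<^sub>S v2 \<in> V" for c1 c2
    by (intro subspace_add[OF subV] subspace_scale[OF subV] v)
  have B_v: "B (c1 *\<^sub>S v1 + c2 *\<^sub>S v2) = (c1 * b11 + c2 * b21) *\<^sub>S z1 + (c1 * b12 + c2 * b22) *\<^sub>S z2" for c1 c2
    by (simp add: B_simps Bv algebra_simps)
  have B_inj: "c1 = 0 \<and> c2 = 0" if "c1 * b11 + c2 * b21 = 0" "c1 * b12 + c2 * b22 = 0" for c1 c2
    by (intro v_indep kerB lin_v) (simp add: B_v that)
  define D where "D = b11 * b22 - b12 * b21"
  have D: "D \<noteq> 0"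
  proof
    assume D0: "D = 0"
    \<comment> \<open>If \<open>D = 0\<close>, the rows of the adjugate are left null vectors of the
      matrix of \<open>B\<close>. They must vanish, so that matrix is zero, which
      \<open>B_inj\<close> refutes as well.\<close>
    have "b22 = 0 \<and> - b12 = 0" "b21 = 0 \<and> - b11 = 0"
      by (rule B_inj; use D0 in \<open>simp add: D_def algebra_simps\<close>)+
    hence "(1::'a) = 0 \<and> (0::'a) = 0" by (intro B_inj) simp_all
    thus False by simp
  qed
  have decompose: "\<exists>c1 c2. \<exists>u'\<in>V. u = c1 *\<^sub>S v1 + c2 *\<^sub>S v2 + A u'" if u: "u \<in> V" for u
  proof -
    obtain x y where xy: "B u = x *\<^sub>S z1 + y *\<^sub>S z2" using ker[OF BV[OF u] AB[OF u]] by blast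
    \<comment> \<open>Cramer's rule for the combination of \<open>v1\<close> and \<open>v2\<close>
      with the same image under \<open>B\<close> as \<open>u\<close>.\<close>
    define c1 c2 where "c1 = (x * b22 - y * b21) / D" and "c2 = (y * b11 - x * b12) / D"
    have Dc: "D * c1 = x * b22 - y * b21" "D * c2 = y * b11 - x * b12"
      using D by (simp_all add: c1_def c2_def)
    have "(x * b22 - y * b21) * b11 + (y * b11 - x * b12) * b21 = D * x"
      "(x * b22 - y * b21) * b12 + (y * b11 - x * b12) * b22 = D * y"
      by (simp_all add: D_def algebra_simps)
    hence "D * (c1 * b11 + c2 * b21) = D * x" "D * (c1 * b12 + c2 * b22) = D * y"
      by (simp_all only: distrib_left mult.assoc[symmetric] Dc)
    hence "c1 * b11 + c2 * b21 = x" "c1 * b12 + c2 * b22 = y" using D by simp_all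
    hence "B (u - (c1 *\<^sub>S v1 + c2 *\<^sub>S v2)) = 0" unfolding B_simps(2) B_v xy by simp
    moreover have "u - (c1 *\<^sub>S v1 + c2 *\<^sub>S v2) \<in> V" by (rule subspace_diff[OF subV u lin_v])
    ultimately obtain u' where "u' \<in> V" "u - (c1 *\<^sub>S v1 + c2 *\<^sub>S v2) = A u'" using kerB by blast
    moreover from this(2) have "u = c1 *\<^sub>S v1 + c2 *\<^sub>S v2 + A u'" by (simp add: algebra_simps)
    ultimately show ?thesis by blast
  qed
  obtain \<alpha> \<delta> \<sigma> where coef: "b11 * (c * \<sigma>) + b12 * \<delta> = b21 * \<alpha> + b22 * \<sigma>"
    "\<alpha> * \<delta> - c * \<sigma> * \<sigma> \<noteq> 0"
    using exists_symmetrizing_scalars[OF D[unfolded D_def] c01] by blast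

  let ?f = "monom (1::'a) a" and ?g = "monom (1::'a) b"
  \<comment> \<open>The mixed Bezoutian is taken in both orders for symmetry, with the smaller
    exponent \<open>b\<close>, since \<phi>' and \<phi>2 both vanish on the image of
    \<open>A ^^ b\<close>.\<close>
  define \<gamma> where "\<gamma> u w = \<alpha> * bez ?f \<phi>1 \<phi>1 u w + \<delta> * bez ?g \<phi>2 \<phi>2 u w
    + \<sigma> * (bez ?g \<phi>' \<phi>2 u w + bez ?g \<phi>2 \<phi>' u w) + \<beta> ((A ^^ a) u) ((A ^^ a) w)" for u w
  have gamma_fun: "functional (\<gamma> u)" for u
  proof (rule functionalI)
    note simps = functional_simps[OF functional_bez[OF phi(1)]] functional_simps[OF functional_bez[OF phi(2)]]
      functional_simps[OF functional_bez[OF phi']] functional_simps[OF fun_beta] pow_simps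
    show "\<gamma> u (x + y) = \<gamma> u x + \<gamma> u y" for x y by (simp add: \<gamma>_def simps algebra_simps)
    show "\<gamma> u (k *\<^sub>S x) = k * \<gamma> u x" for k x by (simp add: \<gamma>_def simps algebra_simps)
  qed
  have gamma_comm: "\<gamma> u w = \<gamma> w u" for u w
    unfolding \<gamma>_def bez_commute[of ?f \<phi>1 \<phi>1 u] bez_commute[of ?g \<phi>2 \<phi>2 u]
      bez_commute[of ?g \<phi>' \<phi>2 u] bez_commute[of ?g \<phi>2 \<phi>' u] beta_comm[of "(A ^^ a) u"]
    by (simp only: add.commute[of "bez ?g \<phi>2 \<phi>' w u"])
  have gamma_A: "\<gamma> (A u) w = \<gamma> u (A w)" if uw: "u \<in> V" "w \<in> V" for u w
  proof -
    have "\<beta> ((A ^^ a) (A u)) ((A ^^ a) w) = \<beta> ((A ^^ a) u) ((A ^^ a) (A w))"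
      using beta(2) pow_in[OF V] uw by (simp add: pow_A self_adjoint_on_def)
    thus ?thesis
      using phi_im phi'_im uw by (simp add: \<gamma>_def bez_adjoint phi phi' act_pow)
  qed
  have gamma_ker: "\<gamma> z w = \<alpha> * (\<phi>1 z * \<phi>1 ((A ^^ (a - 1)) w)) + \<delta> * (\<phi>2 z * \<phi>2 ((A ^^ (b - 1)) w))
      + \<sigma> * (\<phi>' z * \<phi>2 ((A ^^ (b - 1)) w) + \<phi>2 z * \<phi>1 ((A ^^ (a - 1)) w))" if "A z = 0" for z w
  proof -
    have "\<beta> ((A ^^ a) z) ((A ^^ a) w) = 0"
      using ab functional_simps(4)[OF fun_beta] by (simp add: pow_kernel[OF that] beta_comm[of 0])
    thus ?thesis
      using ab phi'_pow[of w] by (simp add: \<gamma>_def bez_monom_kernel[OF phi(1) that] bez_monom_kernel[OF phi(2) that]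
          bez_monom_kernel[OF phi' that])
  qed
  \<comment> \<open>As \<open>A V\<close> is orthogonal to \<open>ker A\<close>, these four values
    determine the pairing of \<open>ker A\<close> with the cokernel; its determinant is
    \<open>\<alpha> * \<delta> - c * \<sigma> * \<sigma>\<close>.\<close>
  have gamma_zv: "\<gamma> z1 v1 = \<alpha>" "\<gamma> z1 v2 = c * \<sigma>" "\<gamma> z2 v1 = \<sigma>" "\<gamma> z2 v2 = \<delta>"
    unfolding gamma_ker[OF Az(1)] gamma_ker[OF Az(2)] z1_def[symmetric] z2_def[symmetric]
      phi_z phi_v1 phi1_v2 phi'_z by simp_all
  have gamma_0: "\<gamma> 0 w = 0" for w using functional_simps(4)[OF gamma_fun] by (simp add: gamma_comm[of 0])
  have gamma_left: "\<gamma> (u + u') w = \<gamma> u w + \<gamma> u' w" "\<gamma> (k *\<^sub>S u) w = k * \<gamma> u w" for u u' w k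
    by (simp_all add: gamma_comm[of _ w] functional_simps[OF gamma_fun])

  have "self_adjoint_on V B \<gamma>"
    unfolding self_adjoint_on_def
  proof (intro ballI)
    fix u w assume uw: "u \<in> V" "w \<in> V"
    have B_im: "\<gamma> (B x) (A y) = 0" if "x \<in> V" "y \<in> V" for x y
      using gamma_A[OF BV[OF that(1)] that(2)] AB[OF that(1)] gamma_0 by simp
    obtain c1 c2 u' where u: "u' \<in> V" "u = c1 *\<^sub>S v1 + c2 *\<^sub>S v2 + A u'" using decompose uw(1) by blast
    obtain d1 d2 w' where w: "w' \<in> V" "w = d1 *\<^sub>S v1 + d2 *\<^sub>S v2 + A w'" using decompose uw(2) by blast
    \<comment> \<open>Only the classes of \<open>x\<close> and \<open>y\<close> modulo
      \<open>A V\<close> matter. The variables are general because \<open>u\<close> and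
      \<open>w\<close> are inserted in both orders.\<close>
    have expand: "\<gamma> (B x) y = (\<gamma> (B v1) v1) * (c1 * d1) + \<gamma> (B v1) v2 * (c1 * d2)
        + \<gamma> (B v2) v1 * (c2 * d1) + \<gamma> (B v2) v2 * (c2 * d2)"
      if "x = c1 *\<^sub>S v1 + c2 *\<^sub>S v2 + A x'" "y = d1 *\<^sub>S v1 + d2 *\<^sub>S v2 + A y'" "x \<in> V" "x' \<in> V" "y' \<in> V"
      for x y x' y' c1 c2 d1 d2
    proof -
      have Bx: "B x = c1 *\<^sub>S B v1 + c2 *\<^sub>S B v2"
        unfolding that(1) using BA[OF that(4)] by (simp add: B_simps)
      have "\<gamma> (B x) y = \<gamma> (B x) (d1 *\<^sub>S v1 + d2 *\<^sub>S v2)"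
        using B_im[OF that(3,5)] unfolding that(2) by (simp add: functional_simps[OF gamma_fun])
      also have "\<dots> = \<gamma> (c1 *\<^sub>S B v1 + c2 *\<^sub>S B v2) (d1 *\<^sub>S v1 + d2 *\<^sub>S v2)"
        by (simp only: Bx)
      finally show ?thesis by (simp add: gamma_left functional_simps[OF gamma_fun] algebra_simps)
    qed
    have sym: "\<gamma> (B v1) v2 = \<gamma> (B v2) v1"
      unfolding Bv by (simp add: gamma_left gamma_zv coef(1))
    have "\<gamma> (B u) w = \<gamma> (B w) u"
      unfolding expand[OF u(2) w(2) uw(1) u(1) w(1)] expand[OF w(2) u(2) uw(2) w(1) u(1)] sym
      by (simp add: algebra_simps)
    thus "\<gamma> (B u) w = \<gamma> u (B w)" by (simp add: gamma_comm[of u])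
  qed
  moreover have "nondegenerate_on V \<gamma>"
    unfolding nondegenerate_on_def
  proof (intro ballI impI)
    fix r assume r: "r \<in> V" "\<forall>w\<in>V. \<gamma> r w = 0"
    have rad_pow: "\<gamma> ((A ^^ n) r) w = 0" if "w \<in> V" for n w
    proof -
      have "self_adjoint_on V A \<gamma>" using gamma_A by (simp add: self_adjoint_on_def)
      from self_adjoint_pow[OF V this r(1) that, of n] show ?thesis using r(2) pow_in[OF V that] by simp
    qed
    \<comment> \<open>The pairing has nonzero determinant, so the radical contains no nonzero kernel
      vector of this form. Hence \<open>r = 0\<close> follows once some power of \<open>A\<close>
      kills \<open>r\<close>.\<close>
    have ker_0: "(A ^^ n) r = 0" if An: "A ((A ^^ n) r) = 0" for n
    proof -
      obtain x y where xy: "(A ^^ n) r = x *\<^sub>S z1 + y *\<^sub>S z2" using ker[OF pow_in[OF V r(1)] An] by blast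
      have e: "x * \<alpha> + y * \<sigma> = 0" "x * (c * \<sigma>) + y * \<delta> = 0"
        using rad_pow[OF v(1), of n] rad_pow[OF v(2), of n] unfolding xy
        by (simp_all add: gamma_left gamma_zv)
      have "x * (\<alpha> * \<delta> - c * \<sigma> * \<sigma>) = \<delta> * (x * \<alpha> + y * \<sigma>) - \<sigma> * (x * (c * \<sigma>) + y * \<delta>)"
        "y * (\<alpha> * \<delta> - c * \<sigma> * \<sigma>) = \<alpha> * (x * (c * \<sigma>) + y * \<delta>) - c * \<sigma> * (x * \<alpha> + y * \<sigma>)"
        by (simp_all add: algebra_simps)
      hence "x = 0" "y = 0" using e coef(2) by simp_all
      thus ?thesis using xy by simp
    qed
    have inj: "r = 0" if "(A ^^ n) r = 0" for n
      using that by (induction n) (auto dest: ker_0)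
    \<comment> \<open>One factor \<open>A ^^ a\<close> makes all Bezoutian terms vanish, the second
      comes from the left argument of the \<beta> summand, and the third is moved over from its
      right argument.\<close>
    have "\<beta> ((A ^^ (a + (a + a))) r) w = 0" if w: "w \<in> V" for w
    proof -
      have 1: "\<phi>1 ((A ^^ i) ((A ^^ a) r)) = 0" "\<phi>2 ((A ^^ i) ((A ^^ a) r)) = 0" for i
      proof -
        have "(A ^^ i) ((A ^^ a) r) = (A ^^ a) ((A ^^ i) r)"
          "(A ^^ i) ((A ^^ a) r) = (A ^^ b) ((A ^^ (i + a - b)) r)"
          using ab by (simp_all add: pow_plus add.commute)
        thus "\<phi>1 ((A ^^ i) ((A ^^ a) r)) = 0" "\<phi>2 ((A ^^ i) ((A ^^ a) r)) = 0"
          using phi_im pow_in[OF V r(1)] by metis+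
      qed
      hence "\<phi>' ((A ^^ i) ((A ^^ a) r)) = 0" for i
        using 1(1)[of "a - b + i"] by (simp add: \<phi>'_def pow_plus add.assoc)
      hence "\<gamma> ((A ^^ a) r) w = \<beta> ((A ^^ a) ((A ^^ a) r)) ((A ^^ a) w)"
        using 1 by (simp add: \<gamma>_def bez_def)
      also have "\<dots> = \<beta> ((A ^^ a) ((A ^^ a) ((A ^^ a) r))) w"
        using self_adjoint_pow[OF V beta(2) _ w] pow_in[OF V] r(1) by simp
      finally show ?thesis using rad_pow[OF w, of a] by (simp add: pow_plus)
    qed
    hence "(A ^^ (a + (a + a))) r = 0"
      using beta(3) pow_in[OF V r(1)] unfolding nondegenerate_on_def by blast
    thus "r = 0" by (rule inj)
  qed
  moreover have "symmetric_form \<gamma>" using gamma_fun gamma_comm by (simp add: symmetric_form_def)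
  moreover have "self_adjoint_on V A \<gamma>" using gamma_A by (simp add: self_adjoint_on_def)
  ultimately show ?thesis by blast
qed


section \<open>Dimension counts\<close>

lemma dim_kernel_image:
  assumes C: "operator C" and V: "subspace V" "finite T" "V \<subseteq> span T"
  shows "dim {u \<in> V. C u = 0} + dim (C ` V) = dim V"
proof -
  let ?K = "{u \<in> V. C u = 0}"
  note C_simps = endo.linear_add[OF C] endo.linear_scale[OF C] endo.linear_0[OF C]
  have subK: "subspace ?K" using V(1) by (auto simp: subspace_def C_simps)
  obtain E where E: "E \<subseteq> ?K" "independent E" "?K \<subseteq> span E" "card E = dim ?K"
    using basis_exists by blast
  have "E \<subseteq> V" using E(1) by blast
  then obtain B where B: "E \<subseteq> B" "B \<subseteq> V" "independent B" "V \<subseteq> span B"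
    using maximal_independent_subset_extend[OF _ E(2)] by metis
  have "B \<subseteq> span T" using B(2) V(3) by (rule order_trans)
  with V(2) B(3) have finB: "finite B" using independent_span_bound by simp
  let ?D = "B - E"
  have indD: "independent ?D" using B(3) by (rule independent_mono) simp
  have spanD: "span ?D \<subseteq> V" using B(2) V(1) by (intro span_minimal) auto
  \<comment> \<open>Such an \<open>x\<close> lies in the spans of the disjoint parts
    \<open>?D\<close> and \<open>E\<close> of the basis \<open>B\<close>, so all its coordinates
    vanish.\<close>
  have "x = 0" if x: "x \<in> span ?D" "C x = 0" for x
  proof -
    have xE: "x \<in> span E" using x spanD E(3) by blast
    have "representation B x = representation ?D x" "representation B x = representation E x"
      using representation_extend[OF B(3) x(1)] representation_extend[OF B(3) xE B(1)] by auto
    hence "representation B x b = 0" for b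
      using representation_ne_zero[of ?D x b] representation_ne_zero[of E x b] by auto
    moreover have "x \<in> span B" using x(1) span_mono[of ?D B] by blast
    ultimately show ?thesis using sum_nonzero_representation_eq[OF B(3), of x] by simp
  qed
  hence inj: "inj_on C (span ?D)" by (subst endo.linear_inj_on_iff_eq_0[OF C]) simp_all
  have ind: "independent (C ` ?D)" by (rule endo.linear_independent_injective_image[OF C indD inj])
  have "C ` V \<subseteq> span (C ` B)"
    using B(4) by (simp add: endo.linear_span_image[OF C] image_mono)
  also have "\<dots> \<subseteq> span (insert 0 (C ` ?D))" using E(1) by (intro span_mono) auto
  finally have "C ` V \<subseteq> span (C ` ?D)" by simp
  moreover have "C ` ?D \<subseteq> C ` V" using B(2) by blast
  ultimately have "dim (C ` V) = card (C ` ?D)" using basis_card_eq_dim[OF _ _ ind] by simp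
  also have "\<dots> = card ?D" using inj span_superset by (intro card_image inj_on_subset[OF inj])
  also have "\<dots> = card B - card E" using finB B(1) by (intro card_Diff_subset) (auto intro: finite_subset)
  finally have "dim (C ` V) = card B - card E" .
  moreover have "card E \<le> card B" using finB B(1) by (rule card_mono)
  moreover have "card B = dim V" using B by (intro basis_card_eq_dim)
  ultimately show ?thesis using E(4) by simp
qed

lemma subspace_eq_of_dim_eq:
  assumes "subspace W" "W \<subseteq> U" "finite T" "U \<subseteq> span T" "dim W = dim U"
  shows "W = U"
proof -
  obtain E where E: "E \<subseteq> W" "independent E" "W \<subseteq> span E" "card E = dim W"
    using basis_exists by blast
  have "E \<subseteq> U" using E(1) assms(2) by blast
  then obtain B where B: "E \<subseteq> B" "B \<subseteq> U" "independent B" "U \<subseteq> span B"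
    using maximal_independent_subset_extend[OF _ E(2)] by metis
  have "B \<subseteq> span T" using B(2) assms(4) by (rule order_trans)
  with assms(3) B(3) have finB: "finite B" using independent_span_bound by simp
  have "card B = card E" using basis_card_eq_dim[OF B(2,4,3)] E(4) assms(5) by simp
  hence "E = B" using card_subset_eq[OF finB B(1)] by simp
  hence "U \<subseteq> W" using B(4) span_minimal[OF E(1) assms(1)] by simp
  thus ?thesis using assms(2) by simp
qed

lemma exists_pair_form:
  assumes V: "fd_invariant V" and B: "operator B"
    and AB: "\<And>u. u \<in> V \<Longrightarrow> B u \<in> V \<and> A (B u) = 0 \<and> B (A u) = 0"
    and dims: "dim (A ` V) + dim (B ` V) = dim V" "dim (B ` V) = 1 \<or> dim (B ` V) = 2"
  shows "\<exists>\<gamma>. symmetric_form \<gamma> \<and> self_adjoint_on V A \<gamma> \<and> self_adjoint_on V B \<gamma> \<and> nondegenerate_on V \<gamma>"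
proof -
  obtain T where T: "subspace V" "finite T" "V \<subseteq> span T" and AV: "\<And>u. u \<in> V \<Longrightarrow> A u \<in> V"
    using V by (auto simp: fd_invariant_def)
  have "A ` V = {u \<in> V. B u = 0}"
  proof (rule subspace_eq_of_dim_eq)
    show "dim (A ` V) = dim {u \<in> V. B u = 0}" using dim_kernel_image[OF B T] dims(1) by simp
    show "subspace (A ` V)" by (rule endo.linear_subspace_image[OF linear_A T(1)])
    show "A ` V \<subseteq> {u \<in> V. B u = 0}" using AB AV by blast
  qed (use T in auto)
  hence "annihilating_pair V B" using V B AB by (auto simp: annihilating_pair_def)
  moreover have "dim {u \<in> V. A u = 0} = dim (B ` V)" using dim_kernel_image[OF linear_A T] dims(1) by simp
  ultimately show ?thesis using dims(2) exists_pair_form_dim1 exists_pair_form_dim2 by metis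
qed

end

subsection \<open>Matrices as operators\<close>

text \<open>Vectors of all lengths in \<open>'a vec\<close> do not form one additive group, so a
  vector of length n is represented by a function on \<open>nat\<close> that vanishes from n
  on.\<close>

definition fun_scale :: "'a::field \<Rightarrow> (nat \<Rightarrow> 'a) \<Rightarrow> nat \<Rightarrow> 'a" where
  "fun_scale c f = (\<lambda>i. c * f i)"

lemma fun_scale_apply [simp]: "fun_scale c f i = c * f i"
  by (simp add: fun_scale_def)

global_interpretation fun_space: vector_space "fun_scale :: 'a::field \<Rightarrow> _"
  by unfold_locales (auto simp: fun_eq_iff algebra_simps)

lemma sum_fun_apply: "(\<Sum>x\<in>I. h x) i = (\<Sum>x\<in>I. h x i :: 'a::comm_monoid_add)"
  by (induction I rule: infinite_finite_induct) auto

definition fun_of_vec :: "'a::zero vec \<Rightarrow> nat \<Rightarrow> 'a" where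
  "fun_of_vec x i = (if i < dim_vec x then x $ i else 0)"

definition bounded_funs :: "nat \<Rightarrow> (nat \<Rightarrow> 'a::zero) set" where
  "bounded_funs n = {f. \<forall>i\<ge>n. f i = 0}"

definition mat_op :: "'a::field mat \<Rightarrow> (nat \<Rightarrow> 'a) \<Rightarrow> nat \<Rightarrow> 'a" where
  "mat_op M f i = (if i < dim_row M then \<Sum>j<dim_col M. M $$ (i, j) * f j else 0)"

definition unit_fun :: "nat \<Rightarrow> nat \<Rightarrow> 'a::zero_neq_one" where
  "unit_fun j i = (if i = j then 1 else 0)"

lemma linear_mat_op: "Vector_Spaces.linear fun_scale fun_scale (mat_op M)"
  by (simp add: Vector_Spaces.linear_iff fun_space.vector_space_axioms fun_eq_iff mat_op_def
      distrib_left sum.distrib sum_distrib_left mult.left_commute)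

lemma mat_op_in: "M \<in> carrier_mat n m \<Longrightarrow> mat_op M f \<in> bounded_funs n"
  by (auto simp: mat_op_def bounded_funs_def)

lemma mat_op_mult:
  assumes "M \<in> carrier_mat n m" "M' \<in> carrier_mat m l"
  shows "mat_op (M * M') f = mat_op M (mat_op M' f)"
proof
  fix i
  show "mat_op (M * M') f i = mat_op M (mat_op M' f) i"
  proof (cases "i < n")
    case True
    have "mat_op (M * M') f i = (\<Sum>j<l. \<Sum>k<m. M $$ (i, k) * M' $$ (k, j) * f j)"
      using assms True
      by (auto simp: mat_op_def scalar_prod_def sum_distrib_right atLeast0LessThan intro!: sum.cong)
    also have "\<dots> = (\<Sum>k<m. \<Sum>j<l. M $$ (i, k) * M' $$ (k, j) * f j)" by (rule sum.swap)
    also have "\<dots> = mat_op M (mat_op M' f) i"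
      using assms True by (auto simp: mat_op_def sum_distrib_left mult.assoc intro!: sum.cong)
    finally show ?thesis .
  qed (use assms in \<open>auto simp: mat_op_def\<close>)
qed

lemma bounded_funs_expand:
  assumes "f \<in> bounded_funs n"
  shows "f = (\<Sum>j<n. fun_scale (f j) (unit_fun j))"
  using assms by (auto simp: fun_eq_iff sum_fun_apply unit_fun_def bounded_funs_def not_less
      if_distrib[of "\<lambda>x. _ * x"] cong: if_cong)

lemma unit_fun_in: "j < n \<Longrightarrow> unit_fun j \<in> bounded_funs n"
  by (auto simp: unit_fun_def bounded_funs_def)

lemma mat_op_unit_fun:
  assumes "M \<in> carrier_mat n m" "j < m"
  shows "mat_op M (unit_fun j) = fun_of_vec (col M j)"
  using assms by (auto simp: fun_eq_iff mat_op_def unit_fun_def fun_of_vec_def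
      if_distrib[of "\<lambda>x. _ * x"] cong: if_cong)

lemma subspace_bounded_funs: "fun_space.subspace (bounded_funs n)"
  by (auto simp: fun_space.subspace_def bounded_funs_def)

lemma bounded_funs_span: "bounded_funs n \<subseteq> fun_space.span (unit_fun ` {..<n})"
proof
  fix f :: "nat \<Rightarrow> 'a" assume "f \<in> bounded_funs n"
  hence "f = (\<Sum>j<n. fun_scale (f j) (unit_fun j))" by (rule bounded_funs_expand)
  also have "\<dots> \<in> fun_space.span (unit_fun ` {..<n})"
    by (intro fun_space.span_sum fun_space.span_scale fun_space.span_base) auto
  finally show "f \<in> fun_space.span (unit_fun ` {..<n})" .
qed

lemma inj_fun_of_vec: "inj_on fun_of_vec (carrier_vec n)"
proof (rule inj_onI)
  fix x y :: "'a vec" assume xy: "x \<in> carrier_vec n" "y \<in> carrier_vec n" "fun_of_vec x = fun_of_vec y"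
  show "x = y"
  proof (rule eq_vecI)
    fix i assume "i < dim_vec y"
    thus "x $ i = y $ i" using xy(1,2) fun_cong[OF xy(3), of i] by (simp add: fun_of_vec_def)
  qed (use xy in auto)
qed

context vec_space
begin

lemma fun_of_vec_lincomb:
  assumes "finite U" "U \<subseteq> carrier_vec n"
  shows "fun_of_vec (lincomb a U) = (\<Sum>x\<in>U. fun_scale (a x) (fun_of_vec x))"
proof
  fix i
  have "dim_vec x = n" if "x \<in> U" for x using assms(2) that by auto
  thus "fun_of_vec (lincomb a U) i = (\<Sum>x\<in>U. fun_scale (a x) (fun_of_vec x)) i"
    using lincomb_dim[OF assms] lincomb_index[OF _ assms(2)]
    by (cases "i < n") (simp_all add: fun_of_vec_def sum_fun_apply)
qed

lemma lin_dep_iff_dependent: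
  assumes U: "U \<subseteq> carrier_vec n"
  shows "lin_dep U \<longleftrightarrow> fun_space.dependent (fun_of_vec ` U)"
proof
  assume "lin_dep U"
  then obtain W a v where W: "finite W" "W \<subseteq> U" "lincomb a W = 0\<^sub>v n" "v \<in> W" "a v \<noteq> 0"
    unfolding lin_dep_def by (auto simp: module_vec_simps)
  have inj: "inj_on fun_of_vec W" using W(2) U by (intro inj_on_subset[OF inj_fun_of_vec[of n]]) auto
  let ?c = "\<lambda>y. a (the_inv_into W fun_of_vec y)"
  have c: "?c (fun_of_vec x) = a x" if "x \<in> W" for x using the_inv_into_f_f[OF inj that] by simp
  have "W \<subseteq> carrier_vec n" using W(2) U by blast
  hence "(\<Sum>x\<in>W. fun_scale (a x) (fun_of_vec x)) = fun_of_vec (0\<^sub>v n)"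
    using fun_of_vec_lincomb[OF W(1), of a] W(3) by simp
  also have "\<dots> = 0" by (auto simp: fun_eq_iff fun_of_vec_def)
  finally have sum0: "(\<Sum>y\<in>fun_of_vec ` W. fun_scale (?c y) y) = 0"
    using c by (simp add: sum.reindex[OF inj])
  have nz: "\<exists>y\<in>fun_of_vec ` W. ?c y \<noteq> 0" using W(4,5) c by auto
  have "finite (fun_of_vec ` W)" "fun_of_vec ` W \<subseteq> fun_of_vec ` U" using W(1,2) by auto
  thus "fun_space.dependent (fun_of_vec ` U)"
    unfolding fun_space.dependent_explicit
    by (intro exI[of _ "fun_of_vec ` W"] exI[of _ ?c] conjI sum0 nz)
next
  assume "fun_space.dependent (fun_of_vec ` U)"
  then obtain t c where t: "finite t" "t \<subseteq> fun_of_vec ` U" "(\<Sum>y\<in>t. fun_scale (c y) y) = 0"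
    "\<exists>y\<in>t. c y \<noteq> 0"
    unfolding fun_space.dependent_explicit by (elim exE conjE) (rule that)
  obtain W where W: "W \<subseteq> U" "finite W" "t = fun_of_vec ` W"
    using finite_subset_image[OF t(1,2)] by blast
  have Wc: "W \<subseteq> carrier_vec n" using W(1) U by blast
  have inj: "inj_on fun_of_vec W" using Wc by (rule inj_on_subset[OF inj_fun_of_vec])
  have "fun_of_vec (lincomb (\<lambda>x. c (fun_of_vec x)) W) = 0"
    using t(3) by (simp add: fun_of_vec_lincomb[OF W(2) Wc] W(3) sum.reindex[OF inj])
  also have "\<dots> = fun_of_vec (0\<^sub>v n)" by (auto simp: fun_eq_iff fun_of_vec_def)
  finally have "lincomb (\<lambda>x. c (fun_of_vec x)) W = 0\<^sub>v n"
    using lincomb_closed[OF Wc] by (intro inj_onD[OF inj_fun_of_vec[of n]]) auto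
  moreover obtain v where "v \<in> W" "c (fun_of_vec v) \<noteq> 0" using t(4) W(3) by auto
  ultimately show "lin_dep U"
    unfolding lin_dep_def using W(1,2) by (auto simp: module_vec_simps)
qed

text \<open>A maximal independent set of columns, which computes \<open>rank\<close>, is carried by
  \<open>fun_of_vec\<close> to a basis of the image.\<close>

lemma rank_eq_dim_image:
  assumes M: "M \<in> carrier_mat n m"
  shows "rank M = fun_space.dim (mat_op M ` bounded_funs m)"
proof -
  let ?P = "\<lambda>U. U \<subseteq> set (cols M) \<and> lin_indpt U" and ?I = "mat_op M ` bounded_funs m"
  have cols: "set (cols M) \<subseteq> carrier_vec n" using cols_dim M by blast
  have "?P {}" by (simp add: lin_dep_def)
  then obtain S where S: "maximal S ?P"
    using maximal_exists_superset[of "set (cols M)" ?P "{}"] by blast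
  let ?B = "fun_of_vec ` S"
  have Sc: "S \<subseteq> set (cols M)" "lin_indpt S" using S by (auto simp: maximal_def)
  have ind: "fun_space.independent ?B"
    using lin_dep_iff_dependent Sc cols by blast
  have col: "fun_of_vec x \<in> fun_space.span ?B" if x: "x \<in> set (cols M)" for x
  proof (rule ccontr)
    assume n: "fun_of_vec x \<notin> fun_space.span ?B"
    hence "fun_space.independent (fun_of_vec ` insert x S)"
      using fun_space.independent_insertI[OF n ind] by simp
    moreover have "insert x S \<subseteq> carrier_vec n" using x Sc(1) cols by blast
    ultimately have "?P (insert x S)" using lin_dep_iff_dependent x Sc(1) by blast
    hence "insert x S = S" using S unfolding maximal_def by blast
    hence "x \<in> S" by blast
    thus False using n fun_space.span_base by blast
  qed
  have unit: "mat_op M (unit_fun j) = fun_of_vec (col M j) \<and> col M j \<in> set (cols M)" if "j < m" for j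
    using mat_op_unit_fun[OF M that] M that by (auto simp: cols_def)
  have "?B \<subseteq> ?I"
  proof
    fix y assume "y \<in> ?B"
    then obtain j where "j < m" "y = fun_of_vec (col M j)" using Sc(1) M by (auto simp: cols_def)
    thus "y \<in> ?I" using mat_op_unit_fun[OF M] unit_fun_in by (metis imageI)
  qed
  moreover have "?I \<subseteq> fun_space.span ?B"
  proof
    fix y assume "y \<in> ?I"
    then obtain f where f: "f \<in> bounded_funs m" "y = mat_op M f" by blast
    interpret op: Vector_Spaces.linear fun_scale fun_scale "mat_op M" by (rule linear_mat_op)
    have "y = (\<Sum>j<m. fun_scale (f j) (mat_op M (unit_fun j)))"
      unfolding f(2) by (subst bounded_funs_expand[OF f(1)]) (simp only: op.sum op.scale)
    also have "\<dots> \<in> fun_space.span ?B"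
      using unit col by (intro fun_space.span_sum fun_space.span_scale) auto
    finally show "y \<in> fun_space.span ?B" .
  qed
  ultimately have "fun_space.dim ?I = card ?B" using fun_space.basis_card_eq_dim ind by metis
  also have "\<dots> = card S"
    using Sc(1) cols by (intro card_image inj_on_subset[OF inj_fun_of_vec[of n]]) auto
  finally show ?thesis using rank_card_indpt[OF M S] by simp
qed

end

text \<open>Read off from the rank of the identity matrix.\<close>

lemma dim_bounded_funs: "fun_space.dim (bounded_funs n :: (nat \<Rightarrow> 'a::field) set) = n"
proof -
  interpret vec_space "TYPE('a)" n .
  have "mat_op (1\<^sub>m n) f = f" if "f \<in> bounded_funs n" for f :: "nat \<Rightarrow> 'a"
  proof
    fix i
    have "(\<Sum>j<n. 1\<^sub>m n $$ (i, j) * f j) = (\<Sum>j<n. if i = j then f j else 0)" if "i < n"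
      using that by (intro sum.cong) auto
    thus "mat_op (1\<^sub>m n) f i = f i" using that by (auto simp: mat_op_def bounded_funs_def)
  qed
  hence "mat_op (1\<^sub>m n) ` bounded_funs n = (bounded_funs n :: (nat \<Rightarrow> 'a) set)" by force
  moreover have "rank (1\<^sub>m n) = n" using det_rank_iff[of "1\<^sub>m n"] by simp
  ultimately show ?thesis using rank_eq_dim_image[of "1\<^sub>m n" n] by simp
qed

lemma exists_intertwining_matrix:
  fixes A B :: "'a::field mat"
  assumes AB: "(A, B) \<in> X n k" and k: "k \<in> {1, 2}"
  obtains S where "S \<in> carrier_mat (n + k) (n + k)" "det S \<noteq> 0"
    "S * A = transpose_mat A * S" "S * B = transpose_mat B * S"
proof -
  let ?N = "n + k" and ?V = "bounded_funs (n + k) :: (nat \<Rightarrow> 'a) set"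
  have A: "A \<in> carrier_mat ?N ?N" and B: "B \<in> carrier_mat ?N ?N"
    and prod: "A * B = 0\<^sub>m ?N ?N" "B * A = 0\<^sub>m ?N ?N"
    and rank: "vec_space.rank ?N A = n" "vec_space.rank ?N B = k"
    using AB by (auto simp: X_def)
  interpret vs: vec_space "TYPE('a)" ?N .
  interpret linear_operator fun_scale "mat_op A"
    by (intro linear_operator.intro linear_operator_axioms.intro fun_space.vector_space_axioms
        linear_mat_op)
  have V: "fd_invariant ?V"
    unfolding fd_invariant_def
    using subspace_bounded_funs mat_op_in[OF A] bounded_funs_span by blast
  have zero: "mat_op (0\<^sub>m ?N ?N) f = 0" for f :: "nat \<Rightarrow> 'a"
    by (simp add: fun_eq_iff mat_op_def)
  have "\<exists>\<gamma>. symmetric_form \<gamma> \<and> self_adjoint_on ?V (mat_op A) \<gamma> \<and> self_adjoint_on ?V (mat_op B) \<gamma>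
      \<and> nondegenerate_on ?V \<gamma>"
  proof (rule exists_pair_form[OF V linear_mat_op])
    show "mat_op B u \<in> ?V \<and> mat_op A (mat_op B u) = 0 \<and> mat_op B (mat_op A u) = 0" for u
      using mat_op_in[OF B, of u] mat_op_mult[OF A B, of u] mat_op_mult[OF B A, of u] prod zero by simp
    show "fun_space.dim (mat_op A ` ?V) + fun_space.dim (mat_op B ` ?V) = fun_space.dim ?V"
      using vs.rank_eq_dim_image[OF A] vs.rank_eq_dim_image[OF B] rank dim_bounded_funs[of ?N, where 'a = 'a] by simp
    show "fun_space.dim (mat_op B ` ?V) = 1 \<or> fun_space.dim (mat_op B ` ?V) = 2"
      using vs.rank_eq_dim_image[OF B] rank k by auto
  qed
  then obtain \<gamma> where \<gamma>: "symmetric_form \<gamma>" "self_adjoint_on ?V (mat_op A) \<gamma>"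
    "self_adjoint_on ?V (mat_op B) \<gamma>" "nondegenerate_on ?V \<gamma>" by blast
  have gamma_fun: "functional (\<gamma> u)" and gamma_comm: "\<gamma> u w = \<gamma> w u" for u w
    using \<gamma>(1) by (simp_all add: symmetric_form_def)
  define S where "S = Matrix.mat ?N ?N (\<lambda>(i, j). \<gamma> (unit_fun i) (unit_fun j))"
  have S: "S \<in> carrier_mat ?N ?N" by (simp add: S_def)
  have expand: "\<gamma> u f = (\<Sum>j<?N. f j * \<gamma> u (unit_fun j))" if "f \<in> ?V" for u f
    by (subst bounded_funs_expand[OF that]) (simp add: functional_simps[OF gamma_fun])
  \<comment> \<open>The entries at (i, j) of the two products are the form at (e_i, C e_j) and at (C
    e_i, e_j), for unit functions e_i.\<close>
  have intertwine: "S * C = transpose_mat C * S"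
    if C: "C \<in> carrier_mat ?N ?N" and adj: "self_adjoint_on ?V (mat_op C) \<gamma>" for C
  proof (rule eq_matI)
    fix i j assume "i < dim_row (transpose_mat C * S)" "j < dim_col (transpose_mat C * S)"
    hence ij: "i < ?N" "j < ?N" using C S by auto
    have C_unit: "mat_op C (unit_fun l) m = C $$ (m, l)" if "l < ?N" "m < ?N" for l m
      using mat_op_unit_fun[OF C that(1)] that C by (simp add: fun_of_vec_def)
    have "(S * C) $$ (i, j) = \<gamma> (unit_fun i) (mat_op C (unit_fun j))"
      using ij S C
      by (subst expand[OF mat_op_in[OF C]])
        (auto simp: S_def scalar_prod_def C_unit atLeast0LessThan mult.commute intro!: sum.cong)
    also have "\<dots> = \<gamma> (unit_fun j) (mat_op C (unit_fun i))"
      using bspec[OF bspec[OF adj[unfolded self_adjoint_on_def] unit_fun_in[OF ij(1)]] unit_fun_in[OF ij(2)]]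
      by (simp add: gamma_comm[of "unit_fun j"])
    also have "\<dots> = (transpose_mat C * S) $$ (i, j)"
      using ij S C
      by (subst expand[OF mat_op_in[OF C]])
        (auto simp: S_def scalar_prod_def C_unit atLeast0LessThan gamma_comm[of "unit_fun j"] intro!: sum.cong)
    finally show "(S * C) $$ (i, j) = (transpose_mat C * S) $$ (i, j)" .
  qed (use C S in auto)
  \<comment> \<open>A null vector of the Gram matrix would lie in the radical of the form.\<close>
  have "det S \<noteq> 0"
  proof
    assume "det S = 0"
    then obtain x where x: "x \<in> carrier_vec ?N" "x \<noteq> 0\<^sub>v ?N" "S *\<^sub>v x = 0\<^sub>v ?N"
      using det_0_iff_vec_prod_zero_field[OF S] by blast
    let ?u = "fun_of_vec x"
    have u: "?u \<in> ?V" using x(1) by (auto simp: fun_of_vec_def bounded_funs_def)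
    have "\<gamma> ?u w = 0" if "w \<in> ?V" for w
    proof -
      have "\<gamma> (unit_fun i) ?u = 0" if i: "i < ?N" for i
      proof -
        have "\<gamma> (unit_fun i) ?u = (S *\<^sub>v x) $ i"
          using i x(1) by (subst expand[OF u])
            (auto simp: S_def scalar_prod_def fun_of_vec_def atLeast0LessThan mult.commute intro!: sum.cong)
        thus ?thesis using x(3) i by simp
      qed
      thus ?thesis by (simp add: expand[OF that] gamma_comm[of ?u])
    qed
    hence u0: "?u = 0" using \<gamma>(4) u by (simp add: nondegenerate_on_def)
    have "x $ i = 0" if "i < ?N" for i using fun_cong[OF u0, of i] x(1) that by (simp add: fun_of_vec_def)
    hence "x = 0\<^sub>v ?N" using x(1) by (intro eq_vecI) auto
    thus False using x(2) by simp
  qed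
  thus ?thesis using that S intertwine A B \<gamma>(2,3) by blast
qed

subsection \<open>Conjugation orbits\<close>

lemma GL_inv:
  assumes "g \<in> carrier (GL TYPE('a::field) m)"
  shows "g \<in> carrier_mat m m" "inv\<^bsub>GL TYPE('a) m\<^esub> g \<in> carrier_mat m m"
    "g * inv\<^bsub>GL TYPE('a) m\<^esub> g = 1\<^sub>m m" "inv\<^bsub>GL TYPE('a) m\<^esub> g * g = 1\<^sub>m m"
proof -
  interpret R: ring "ring_mat TYPE('a) m ()" by (rule ring_mat)
  have g: "g \<in> Units (ring_mat TYPE('a) m ())" using assms by (simp add: GL_def units_of_def)
  have inv: "inv\<^bsub>GL TYPE('a) m\<^esub> g = inv\<^bsub>ring_mat TYPE('a) m ()\<^esub> g"
    unfolding GL_def by (rule R.units_of_inv[OF g])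
  show "g \<in> carrier_mat m m" "inv\<^bsub>GL TYPE('a) m\<^esub> g \<in> carrier_mat m m"
    "g * inv\<^bsub>GL TYPE('a) m\<^esub> g = 1\<^sub>m m" "inv\<^bsub>GL TYPE('a) m\<^esub> g * g = 1\<^sub>m m"
    using R.Units_closed[OF g] R.Units_inv_closed[OF g] R.Units_r_inv[OF g] R.Units_l_inv[OF g]
    unfolding inv by (simp_all add: ring_mat_simps)
qed

lemma GL_memI:
  fixes h :: "'a::field mat"
  assumes "h \<in> carrier_mat m m" "h' \<in> carrier_mat m m" "h * h' = 1\<^sub>m m" "h' * h = 1\<^sub>m m"
  shows "h \<in> carrier (GL TYPE('a) m)" "inv\<^bsub>GL TYPE('a) m\<^esub> h = h'"
proof -
  interpret R: ring "ring_mat TYPE('a) m ()" by (rule ring_mat)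
  have h: "h \<in> Units (ring_mat TYPE('a) m ())"
    using assms by (auto simp: Units_def ring_mat_simps)
  thus "h \<in> carrier (GL TYPE('a) m)" by (simp add: GL_def units_of_def)
  have "inv\<^bsub>ring_mat TYPE('a) m ()\<^esub> h = h'"
    using assms by (intro R.inv_char) (simp_all add: ring_mat_simps)
  thus "inv\<^bsub>GL TYPE('a) m\<^esub> h = h'" unfolding GL_def using R.units_of_inv[OF h] by simp
qed

text \<open>By \<open>S * C = transpose_mat C * S\<close>, transposing g C g^-1 gives g^-t S C S^-1
  g^t; so \<open>h\<close> is the inverse transpose of \<open>g\<close> times \<open>S\<close>, for
  both matrices of the pair.\<close>

lemma theta_conj_action:
  fixes A B :: "'a::field mat"
  assumes AB: "(A, B) \<in> X n k" and k: "k \<in> {1, 2}" and g: "g \<in> carrier (GL TYPE('a) (n + k))"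
  shows "\<exists>h\<in>carrier (GL TYPE('a) (n + k)).
    theta (conj_action n k g (A, B)) = conj_action n k h (A, B)"
proof -
  let ?N = "n + k" and ?t = transpose_mat
  have A: "A \<in> carrier_mat ?N ?N" and B: "B \<in> carrier_mat ?N ?N" using AB by (auto simp: X_def)
  obtain S where S: "S \<in> carrier_mat ?N ?N" "det S \<noteq> 0" "S * A = ?t A * S" "S * B = ?t B * S"
    using exists_intertwining_matrix[OF AB k] by blast
  have "S \<in> Units (ring_mat TYPE('a) ?N ())" by (rule det_non_zero_imp_unit[OF S(1,2)])
  then obtain S' where S': "S' \<in> carrier_mat ?N ?N" "S * S' = 1\<^sub>m ?N" "S' * S = 1\<^sub>m ?N"
    by (auto simp: Units_def ring_mat_simps)
  define g' where "g' = inv\<^bsub>GL TYPE('a) ?N\<^esub> g"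
  note g_inv = GL_inv[OF g, folded g'_def]
  let ?h = "?t g' * S" and ?h' = "S' * ?t g"
  have tg: "?t g \<in> carrier_mat ?N ?N" "?t g' \<in> carrier_mat ?N ?N" using g_inv by auto
  have tgg: "?t g' * ?t g = 1\<^sub>m ?N" "?t g * ?t g' = 1\<^sub>m ?N"
    unfolding transpose_mult[OF g_inv(1,2), symmetric] transpose_mult[OF g_inv(2,1), symmetric] g_inv(3,4)
    by simp_all
  have h: "?h \<in> carrier_mat ?N ?N" "?h' \<in> carrier_mat ?N ?N" using tg S(1) S'(1) by auto
  have "?h * ?h' = ?t g' * (S * S') * ?t g" "?h' * ?h = S' * (?t g * ?t g') * S"
    using tg S(1) S'(1) by (simp_all add: assoc_mult_mat[of _ ?N ?N _ ?N _ ?N])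
  hence "?h * ?h' = 1\<^sub>m ?N" "?h' * ?h = 1\<^sub>m ?N"
    using tgg tg S(1) S' by simp_all
  note h_GL = GL_memI[OF h this]
  have "?t (g * C * g') = ?h * C * ?h'"
    if C: "C \<in> carrier_mat ?N ?N" and SC: "S * C = ?t C * S" for C
  proof -
    have "?t C = ?t C * (S * S')" using S' C by simp
    also have "\<dots> = S * C * S'"
      unfolding SC using S(1) S'(1) C by (intro assoc_mult_mat[symmetric]) auto
    finally have tC: "?t C = S * C * S'" .
    have "?t (g * C * g') = ?t g' * ?t C * ?t g"
      using C g_inv tg by (simp add: transpose_mult[of _ ?N ?N _ ?N] assoc_mult_mat[of _ ?N ?N _ ?N _ ?N])
    also have "\<dots> = ?t g' * (S * C * S') * ?t g" by (simp only: tC)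
    also have "\<dots> = ?h * C * ?h'"
      using S(1) S'(1) C tg by (simp add: assoc_mult_mat[of _ ?N ?N _ ?N _ ?N])
    finally show ?thesis .
  qed
  hence "theta (conj_action n k g (A, B)) = conj_action n k ?h (A, B)"
    using AB A B S(3,4) by (simp add: theta_def conj_action_def h_GL(2) g'_def[symmetric])
  thus ?thesis using h_GL(1) by blast
qed

theorem proposition6:
  fixes n k :: nat and orb :: "('a::field mat \<times> 'a mat) set"
  assumes "nonarch_local_field TYPE('a) \<or> finite (UNIV :: 'a set)"
    and "k \<in> {1, 2}"
    and "orb \<in> orbits (GL TYPE('a) (n + k)) (X n k) (conj_action n k)"
  shows "theta ` orb = orb"
proof -
  obtain A B where AB: "(A, B) \<in> X n k"
    and orb: "orb = orbit (GL TYPE('a) (n + k)) (conj_action n k) (A, B)"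
    using assms(3) by (auto simp: orbits_def)
  have closed: "theta y \<in> orb" if y: "y \<in> orb" for y
  proof -
    obtain g where g: "g \<in> carrier (GL TYPE('a) (n + k))" "y = conj_action n k g (A, B)"
      using y by (auto simp: orb orbit_def)
    show ?thesis using theta_conj_action[OF AB assms(2) g(1)] g(2) by (auto simp: orb orbit_def)
  qed
  \<comment> \<open>Being an involution turns the inclusion of the image of \<open>orb\<close> in
    \<open>orb\<close> into equality.\<close>
  moreover have "theta (theta y) = y" for y :: "'a mat \<times> 'a mat"
    by (cases y) (simp add: theta_def)
  ultimately show ?thesis by (metis image_subset_iff imageI subsetI subset_antisym)
qed

end
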